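(* Let $V$ be a subgroup of $\mathcal{L}_n$ with triple $(s,V_0,v)$. Then $V$ is closed in the pro-$p$ topology of $\mathcal{L}_n$ if and only if one of the following holds: (i) $s=0$ and $V_0$ is closed as a subset of $\mathbb{F}_p[[\mathbb{Z}_p]]^n$ (that is, $V_0$ is the intersection of its closure in $\mathbb{F}_p[[\mathbb{Z}_p]]^n$ with $\mathcal{A}_n$); or (ii) $s>0$, $e(V_0)$ divides $p^{|s|_p}$, ${\det}^*V_0$ is a power of $1-x$, and for any integer $q$ with $0<q<s$ and $|q|_p\ge|s|_p$, $$(x^q-1)v\notin(x^s-1)\mathcal{A}_n+(x-1)^{p^{|s|_p}}V_0 .$$
   Context: $p$ is a fixed prime, $n\ge 1$, $R=\mathbb{F}_p[x,x^{-1}]=\mathbb{F}_p[\mathbb{Z}]$. $\mathcal{A}_n=\bigoplus_{\mathbb{Z}}(\mathbb{Z}/p\mathbb{Z})^n$ is identified with the additive group of $R^n$, so that the shift by one on $\mathcal{A}_n$ is multiplication by $x$. $\mathcal{L}_n=(\mathbb{Z}/p\mathbb{Z})^n\wr\mathbb{Z}=\mathcal{A}_n\rtimes\mathbb{Z}$, with elements written $(v,s)$ and multiplication $(v,s)(w,t)=(v+x^sw,s+t)$; $\mathcal{A}_n$ is identified with $\{(v,0)\}$. The triple $(s,V_0,v)$ of a subgroup $V\le\mathcal{L}_n$: $s\ge 0$ is the integer such that $s\mathbb{Z}$ is the image of $V$ under the projection to $\mathbb{Z}$, $V_0=V\cap\mathcal{A}_n$ (it satisfies $x^sV_0=V_0$),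 and $v\in\mathcal{A}_n$ is any element with $(v,s)\in V$ (well defined modulo $V_0$; for $s=0$ one takes $v=0$). For an integer $q>0$, $|q|_p$ denotes the exponent of the highest power of $p$ dividing $q$ (the $p$-adic valuation). For a subgroup $U\subset\mathcal{A}_n$, $e(U)$ is the minimal positive integer $e$ with $x^eU=U$ ($+\infty$ if none exists). If $e=e(U)$ is finite, consider $\mathcal{A}_n$ as an $R$-module with $x$ acting by $x*v=x^{e}v$; it is free of rank $ne$, and $U$ is an $R$-submodule. Write $\mathcal{A}_n/U\cong\bigoplus_{i=1}^m R/q_i^{r_i}R$ as an $R$-module for this structure, with $r_i\ge 1$ and each $q_i$ either $0$ or an irreducible polynomial in $\mathbb{F}_p[x]$ with $q_i(0)=1$; then ${\det}^*U=\prod_{i:\,q_i\ne0}q_i^{r_i}$. Powers of $1-x$ include $(1-x)^0=1$. $\mathbb{F}_p[[\mathbb{Z}_p]]=\varprojlim_m\mathbb{F}_p[\mathbb{Z}/p^m\mathbb{Z}]$ with the projective limit topology; $R=\mathbb{F}_p[\mathbb{Z}]$ embeds in it naturally, so $\mathcal{A}_n=R^n\subset\mathbb{F}_p[[\mathbb{Z}_p]]^n$. A subgroup of a group $G$ is closed in the pro-$p$ topology if it is closed for the topology on $G$ with basis of neighbourhoods of $1$ the normal subgroups of index a power of $p$. *)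

theory Defs
  imports
    "HOL-Analysis.Analysis"
    "HOL-Algebra.Module"
    "HOL-Algebra.AbelCoset"
    "HOL-Library.Poly_Mapping"
    "HOL-Library.Extended_Nat"
    "Berlekamp_Zassenhaus.Finite_Field"
begin

unbundle no fps_syntax

text \<open>
  The prime \<open>p\<close> is \<open>CARD('p)\<close> for a type \<open>'p\<close> of class \<open>prime_card\<close>, the field with \<open>p\<close> elements
  is \<open>'p mod_ring\<close>, and \<open>n\<close> is \<open>CARD('n)\<close>. The Laurent polynomial ring is the group algebra of
  the integers, i.e. finitely supported functions with the convolution product of
  \<open>Poly_Mapping\<close>.
\<close>

type_synonym 'p laurent = "int \<Rightarrow>\<^sub>0 'p mod_ring"

abbreviation xpow :: "int \<Rightarrow> ('p::prime_card) laurent" where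
  "xpow k \<equiv> Poly_Mapping.single k 1"

text \<open>For a map \<open>f\<close> between exponent groups, the induced linear map of group algebras,
  sending \<open>x\<^sup>k\<close> to \<open>x\<close> to the power \<open>f k\<close>.\<close>

definition push_exponents :: "(int \<Rightarrow> int) \<Rightarrow> ('p::prime_card) laurent \<Rightarrow> 'p laurent" where
  "push_exponents f a =
     (\<Sum>k\<in>Poly_Mapping.keys a. Poly_Mapping.single (f k) (Poly_Mapping.lookup a k))"


section \<open>The group and its subgroups\<close>

type_synonym ('p, 'n) lamp = "'p laurent ^ 'n"

definition lamplighter :: "(('p::prime_card, 'n::finite) lamp \<times> int) monoid" where
  "lamplighter = \<lparr>carrier = UNIV,
     mult = (\<lambda>(v, s) (w, t). (v + xpow s *s w, s + t)),
     one = (0, 0)\<rparr>"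

lemma group_lamplighter: "group (lamplighter :: (('p::prime_card, 'n::finite) lamp \<times> int) monoid)"
proof (rule groupI)
  fix a :: "('p, 'n) lamp \<times> int"
  obtain v s where a: "a = (v, s)" by (cases a)
  have "xpow (- s) *s (- v) + xpow (- s) *s v = (0 :: ('p, 'n) lamp)"
    by (simp flip: vector_add_ldistrib)
  then show "\<exists>b\<in>carrier lamplighter. b \<otimes>\<^bsub>lamplighter\<^esub> a = \<one>\<^bsub>lamplighter\<^esub>"
    by (intro bexI[of _ "(xpow (- s) *s (- v), - s)"]) (simp_all only: lamplighter_def a
        monoid.simps partial_object.simps case_prod_conv UNIV_I add.left_inverse)
qed (auto simp: lamplighter_def vector_add_ldistrib vector_smult_assoc mult_single algebra_simps
          vector_smult_lid single_one)

definition subgroup_triple ::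
    "(('p::prime_card, 'n::finite) lamp \<times> int) set \<Rightarrow> nat \<Rightarrow> ('p, 'n) lamp set \<Rightarrow> ('p, 'n) lamp \<Rightarrow> bool"
  where
  "subgroup_triple V s V0 v \<longleftrightarrow>
     snd ` V = range (\<lambda>k. int s * k) \<and>
     V0 = {u. (u, 0) \<in> V} \<and>
     (v, int s) \<in> V \<and> (s = 0 \<longrightarrow> v = 0)"

text \<open>A nonempty intersection of two of the cosets below is again one of them, so they form a
  base; those through the identity are the normal subgroups of \<open>p\<close>-power index. An infinite index
  has \<open>card\<close> equal to \<open>0\<close> and is therefore excluded.\<close>

definition pro_p_topology :: "nat \<Rightarrow> ('a, 'b) monoid_scheme \<Rightarrow> 'a topology" where
  "pro_p_topology p G = topology_generated_by
     {g <#\<^bsub>G\<^esub> N |g N. g \<in> carrier G \<and> N \<lhd> G \<and> (\<exists>k. card (rcosets\<^bsub>G\<^esub> N) = p ^ k)}"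


section \<open>The completed group algebra\<close>

text \<open>The group algebra of the integers modulo \<open>p\<^sup>m\<close>, residue classes being represented by
  \<open>0, \<dots>, p\<^sup>m - 1\<close>. Only the underlying spaces and the transition maps matter below.\<close>

definition group_algebra_mod :: "nat \<Rightarrow> ('p::prime_card) laurent set" where
  "group_algebra_mod m = {a. Poly_Mapping.keys a \<subseteq> {0..<int CARD('p) ^ m}}"

definition reduce_mod :: "nat \<Rightarrow> ('p::prime_card) laurent \<Rightarrow> 'p laurent" where
  "reduce_mod m = push_exponents (\<lambda>k. k mod int CARD('p) ^ m)"

definition completed_algebra :: "(nat \<Rightarrow> ('p::prime_card) laurent) topology" where
  "completed_algebra =
     subtopology (product_topology (\<lambda>m. discrete_topology (group_algebra_mod m)) UNIV)
       {f. \<forall>m. reduce_mod m (f (Suc m)) = f m}"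

definition completed_lamp :: "('n::finite \<Rightarrow> nat \<Rightarrow> ('p::prime_card) laurent) topology" where
  "completed_lamp = product_topology (\<lambda>_. completed_algebra) UNIV"

definition embed_lamp :: "('p::prime_card, 'n::finite) lamp \<Rightarrow> 'n \<Rightarrow> nat \<Rightarrow> 'p laurent" where
  "embed_lamp v = (\<lambda>i m. reduce_mod m (v $ i))"

definition closed_in_completion :: "('p::prime_card, 'n::finite) lamp set \<Rightarrow> bool" where
  "closed_in_completion U \<longleftrightarrow>
     embed_lamp ` U = (Abstract_Topology.closure_of completed_lamp (embed_lamp ` U)) \<inter> range embed_lamp"


section \<open>Quotient modules and the invariants of a subgroup\<close>

text \<open>As usual for the \<open>module\<close> records, the fields \<open>mult\<close> and \<open>one\<close> are irrelevant.\<close>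

definition laurent_module ::
    "(('p::prime_card) laurent \<Rightarrow> 'm \<Rightarrow> 'm) \<Rightarrow> ('p laurent, 'm::ab_group_add) module" where
  "laurent_module act = \<lparr>carrier = UNIV, mult = undefined, one = undefined,
     ring.zero = 0, add = (+), smult = act\<rparr>"

definition quotient_module :: "('r, 'm) module \<Rightarrow> 'm set \<Rightarrow> ('r, 'm set) module" where
  "quotient_module M U = \<lparr>carrier = a_rcosets\<^bsub>M\<^esub> U, mult = undefined, one = undefined,
     ring.zero = U, add = (\<lambda>X Y. X <+>\<^bsub>M\<^esub> Y),
     smult = (\<lambda>r X. \<Union>y\<in>X. U +>\<^bsub>M\<^esub> (r \<odot>\<^bsub>M\<^esub> y))\<rparr>"

text \<open>Finite direct sum of the modules in a list.\<close>

definition direct_sum_module :: "('r, 'm) module list \<Rightarrow> ('r, nat \<Rightarrow> 'm) module" where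
  "direct_sum_module Ms = (let I = {..<length Ms} in
     \<lparr>carrier = (\<Pi>\<^sub>E i\<in>I. carrier (Ms ! i)), mult = undefined, one = undefined,
      ring.zero = (\<lambda>i\<in>I. \<zero>\<^bsub>Ms ! i\<^esub>),
      add = (\<lambda>f g. \<lambda>i\<in>I. f i \<oplus>\<^bsub>Ms ! i\<^esub> g i),
      smult = (\<lambda>r f. \<lambda>i\<in>I. r \<odot>\<^bsub>Ms ! i\<^esub> f i)\<rparr>)"

text \<open>Isomorphism of modules all of whose scalars range over the whole type \<open>'r\<close>.\<close>

definition module_isomorphic :: "('r, 'm) module \<Rightarrow> ('r, 'k) module \<Rightarrow> bool" where
  "module_isomorphic M N \<longleftrightarrow>
     (\<exists>h. bij_betw h (carrier M) (carrier N) \<and>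
       (\<forall>a\<in>carrier M. \<forall>b\<in>carrier M. h (a \<oplus>\<^bsub>M\<^esub> b) = h a \<oplus>\<^bsub>N\<^esub> h b) \<and>
       (\<forall>r. \<forall>a\<in>carrier M. h (r \<odot>\<^bsub>M\<^esub> a) = r \<odot>\<^bsub>N\<^esub> h a))"

definition period :: "('p::prime_card, 'n::finite) lamp set \<Rightarrow> enat" where
  "period U = Inf {enat e |e. 0 < e \<and> (\<lambda>u. xpow (int e) *s u) ` U = U}"

text \<open>The additive group of lamp configurations with \<open>x\<close> acting as \<open>x\<^sup>e\<close>.\<close>

definition lamp_module :: "nat \<Rightarrow> (('p::prime_card) laurent, ('p, 'n::finite) lamp) module" where
  "lamp_module e = laurent_module (\<lambda>a v. push_exponents (\<lambda>k. int e * k) a *s v)"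

definition laurent_of_poly :: "('p::prime_card) mod_ring poly \<Rightarrow> 'p laurent" where
  "laurent_of_poly q = (\<Sum>i\<le>degree q. Poly_Mapping.single (int i) (poly.coeff q i))"

definition cyclic_module ::
    "('p::prime_card) mod_ring poly \<Rightarrow> nat \<Rightarrow> ('p laurent, 'p laurent set) module" where
  "cyclic_module q r =
     quotient_module (laurent_module (*)) (range (\<lambda>a. laurent_of_poly q ^ r * a))"

definition cyclic_decomposition ::
    "('p::prime_card, 'n::finite) lamp set \<Rightarrow> ('p mod_ring poly \<times> nat) list \<Rightarrow> bool" where
  "cyclic_decomposition U qs \<longleftrightarrow>
     (\<forall>(q, r)\<in>set qs. 1 \<le> r \<and> (q = 0 \<or> irreducible q \<and> poly q 0 = 1)) \<and>
     module_isomorphic (quotient_module (lamp_module (the_enat (period U))) U)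
       (direct_sum_module (map (\<lambda>(q, r). cyclic_module q r) qs))"

text \<open>Meaningful for subgroups of finite period only. The decomposition exists and is unique up to
  order (the Laurent polynomials form a principal ideal domain), so the product does not depend
  on which one is chosen.\<close>

definition det_star :: "('p::prime_card, 'n::finite) lamp set \<Rightarrow> 'p mod_ring poly" where
  "det_star U = (let qs = (SOME qs. cyclic_decomposition U qs) in
     prod_list (map (\<lambda>(q, r). q ^ r) (filter (\<lambda>(q, r). q \<noteq> 0) qs)))"

end

theory Submission
  imports Defs
begin

text \<open>
  Every normal subgroup of \<open>p\<close>-power index contains one of the subgroups
  \<open>N\<^sub>m = (x - 1)\<^bsup>p^m\<^esup>A \<rtimes> p\<^sup>m\<int>\<close>, which are themselves normal of \<open>p\<close>-power index, so closedness of \<open>V\<close>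
  is a matter of congruences modulo all \<open>N\<^sub>m\<close>; no completion is needed. Put \<open>y = x\<^bsup>p^|s|\<^esup>\<close>, where
  \<open>|s|\<close> is the \<open>p\<close>-adic valuation. Modulo a given \<open>p\<^sup>m\<close> some multiple of \<open>s\<close> is congruent to \<open>p\<^bsup>|s|\<^esup>\<close>.
  Hence a closed \<open>V\<^sub>0\<close> is invariant under \<open>y\<close>, and \<open>x\<^sup>s - 1\<close> and \<open>y - 1\<close> are
  associated up to arbitrarily high powers of \<open>x - 1\<close>. So, once \<open>V\<^sub>0\<close> is closed, a vector \<open>a\<close> occurs at
  level \<open>q\<close> in the closure of \<open>V\<close> exactly when \<open>(x\<^sup>q - 1)v - (x\<^sup>s - 1)a \<in> (y - 1)V\<^sub>0\<close>. Finally, \<open>V\<^sub>0\<close> is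
  closed when \<open>x - 1\<close> acts surjectively on no summand \<open>R/q\<^sup>rR\<close> of \<open>A/V\<^sub>0\<close>, i.e. when every nonzero \<open>q\<close>
  is \<open>1 - x\<close>.
\<close>

section \<open>Laurent polynomials\<close>

text \<open>The obstacle for s > 0 is that the p-adic limit replaces sZ by its closure p^d Z, with d
  the p-adic valuation of s, while the quotient of x^s - 1 by y - 1 is in general a unit only after
  completion and not in R. Its inverse is therefore approximated at each level by a geometric sum G
  in x^s, which maps V0 to itself. The vector of V above s k is (x^(sk) - 1)/(x^s - 1) v modulo V0;
  multiplying through by x^s - 1 removes the denominator, and the factor is cancelled afterwards.
  Since y - 1 = (x - 1)^(p^d), the cancellation costs p^d powers of x - 1, and the shift from m to m
  + d + 1 pays for this. The multiples of p^d strictly between 0 and s are the nonzero residues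
  modulo s of the closure of sZ, which explains the range of q in (ii). For the determinant, e =
  e(V0) is a power of p, so x^(p^m) - 1 acts in the twisted module structure as x^(e p^m) - 1: the
  filtration seen by the cyclic summands is cofinal with the one that defines the topology.\<close>

lemma laurent_induct [case_names add single]:
  fixes a :: "('p::prime_card) laurent"
  assumes "\<And>a b. P a \<Longrightarrow> P b \<Longrightarrow> P (a + b)" and "\<And>k c. P (Poly_Mapping.single k c)"
  shows "P a"
proof (induction a rule: update_induct)
  case const
  show ?case using assms(2)[of 0 0] by simp
next
  case (update f k c)
  have "Poly_Mapping.update k c f = f + Poly_Mapping.single k c"
    using update.hyps by (intro poly_mapping_eqI)
      (auto simp: lookup_update lookup_add lookup_single when_def in_keys_iff)
  with assms update show ?case by simp
qed

lemma lookup_push_exponents: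
  "Poly_Mapping.lookup (push_exponents f a) j
     = (\<Sum>k\<in>Poly_Mapping.keys a. Poly_Mapping.lookup a k when f k = j)"
  unfolding push_exponents_def by (simp add: lookup_sum lookup_single)

lemma push_exponents_add: "push_exponents f (a + b) = push_exponents f a + push_exponents f b"
  unfolding push_exponents_def
  by (rule setsum_keys_plus_distrib) (simp_all add: single_add)

lemma push_exponents_single [simp]:
  "push_exponents f (Poly_Mapping.single k c) = Poly_Mapping.single (f k) c"
  by (cases "c = 0") (simp_all add: push_exponents_def)

lemma push_exponents_zero [simp]: "push_exponents f 0 = 0"
  by (simp add: push_exponents_def)

lemma push_exponents_uminus: "push_exponents f (- a) = - push_exponents f a"
  using push_exponents_add[of f a "- a"] by (simp add: eq_neg_iff_add_eq_0 add.commute)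

lemma push_exponents_diff: "push_exponents f (a - b) = push_exponents f a - push_exponents f b"
  using push_exponents_add[of f a "- b"] by (simp add: push_exponents_uminus)

lemma push_exponents_mult:
  assumes "\<And>j k. f (j + k) = f j + f k"
  shows "push_exponents f (a * b) = push_exponents f a * push_exponents f b"
proof (induction a rule: laurent_induct)
  case (single j c)
  show ?case
  proof (induction b rule: laurent_induct)
    case (single k d)
    show ?case by (simp add: mult_single assms)
  qed (simp add: push_exponents_add distrib_left)
qed (simp add: push_exponents_add distrib_right)

lemma push_exponents_one [simp]: "f 0 = 0 \<Longrightarrow> push_exponents f 1 = 1"
  by (simp flip: single_one)

lemma push_exponents_comp: "push_exponents f (push_exponents g a) = push_exponents (f \<circ> g) a"
  by (induction a rule: laurent_induct) (simp_all add: push_exponents_add)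

lemma push_exponents_id [simp]: "push_exponents (\<lambda>k. k) a = a"
  by (induction a rule: laurent_induct) (simp_all add: push_exponents_add)

section \<open>Powers of \<open>x - 1\<close>\<close>

lemma xpow_mult: "xpow j * xpow k = xpow (j + k)"
  by (simp add: mult_single)

lemma xpow_0 [simp]: "xpow 0 = 1"
  by (rule single_one)

lemma xpow_power: "xpow k ^ m = xpow (int m * k)"
  by (induction m) (simp_all add: xpow_mult algebra_simps)

lemma CHAR_laurent: "CHAR(('p::prime_card) laurent) = CARD('p)"
proof -
  have "of_nat n = (0 :: 'p laurent) \<longleftrightarrow> CARD('p) dvd n" for n
  proof -
    have "of_nat n = (0 :: 'p laurent) \<longleftrightarrow> of_nat n = (0 :: 'p mod_ring)"
      unfolding single_of_nat[symmetric, where 'a=int and 'b="'p mod_ring"]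
      by (metis lookup_single_eq lookup_zero single_zero)
    then show ?thesis by (simp add: of_nat_eq_0_iff_char_dvd semiring_char_mod_ring)
  qed
  then show ?thesis by (intro CHAR_eqI) auto
qed

text \<open>Frobenius is additive in characteristic p. It turns the generator of each congruence
  ideal into a power of x - 1, which is how the power of x - 1 in condition (ii) arises.\<close>

lemma xpow_minus_one_power:
  "(xpow k - 1 :: ('p::prime_card) laurent) ^ (CARD('p) ^ m) = xpow (int CARD('p) ^ m * k) - 1"
proof -
  have "((xpow k - 1) + 1 :: 'p laurent) ^ (CARD('p) ^ m) = (xpow k - 1) ^ (CARD('p) ^ m) + 1 ^ (CARD('p) ^ m)"
    by (rule freshmans_dream') (simp_all add: CHAR_laurent prime_card)
  then show ?thesis by (simp add: xpow_power)
qed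

lemma xpow_minus_one_dvd:
  assumes "j dvd k"
  shows "xpow j - 1 dvd (xpow k - 1 :: ('p::prime_card) laurent)"
proof -
  have nat: "xpow j - 1 dvd (xpow (int i * j) - 1 :: 'p laurent)" for i
    by (metis xpow_power power_diff_1_eq dvd_triv_left)
  obtain i where i: "k = j * i" using assms by auto
  show ?thesis
  proof (cases "i \<ge> 0")
    case True
    then show ?thesis using nat[of "nat i"] i by (simp add: mult.commute)
  next
    case False
    then have "xpow j - 1 dvd (xpow (- k) - 1 :: 'p laurent)"
      using nat[of "nat (- i)"] i by (simp add: mult.commute)
    \<comment> \<open>Multiplication by the unit \<open>- xpow k\<close> exchanges x^(-k) - 1 and
      x^k - 1, so natural multiples of j suffice.\<close>
    moreover have "xpow k - 1 = - xpow k * (xpow (- k) - 1 :: 'p laurent)"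
      by (simp add: algebra_simps xpow_mult)
    ultimately show ?thesis by (metis dvd_mult)
  qed
qed

lemma xpow_diff_dvd:
  assumes "i dvd j - k"
  shows "xpow i - 1 dvd (xpow j - xpow k :: ('p::prime_card) laurent)"
proof -
  have "xpow j - xpow k = xpow k * (xpow (j - k) - 1 :: 'p laurent)"
    by (simp add: algebra_simps xpow_mult)
  with xpow_minus_one_dvd[OF assms, where ?'p='p] show ?thesis by (metis dvd_mult)
qed

text \<open>The group algebra of Z/p^m is the quotient of R by the ideal of x^(p^m) - 1: every
  element agrees with its reduction modulo the ideal (\<open>reduced\<close>), and the reduction
  kills the ideal (\<open>zero\<close>).\<close>

lemma reduce_mod_eq_iff:
  fixes a b :: "('p::prime_card) laurent"
  shows "reduce_mod m a = reduce_mod m b \<longleftrightarrow> xpow (int CARD('p) ^ m) - 1 dvd a - b"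
proof -
  let ?P = "int CARD('p) ^ m"
  have reduced: "xpow ?P - 1 dvd c - reduce_mod m c" for c :: "'p laurent"
  proof (induction c rule: laurent_induct)
    case (add c d)
    have "c + d - reduce_mod m (c + d) = (c - reduce_mod m c) + (d - reduce_mod m d)"
      by (simp add: reduce_mod_def push_exponents_add)
    with dvd_add[OF add] show ?case by (simp only:)
  next
    case (single k c)
    have "Poly_Mapping.single k c - reduce_mod m (Poly_Mapping.single k c)
      = Poly_Mapping.single 0 c * (xpow k - xpow (k mod ?P))"
      by (simp add: reduce_mod_def algebra_simps mult_single)
    moreover have "xpow ?P - 1 dvd (xpow k - xpow (k mod ?P) :: 'p laurent)"
      by (intro xpow_diff_dvd) (metis dvd_minus_mod)
    ultimately show ?case by simp
  qed
  have zero: "reduce_mod m ((xpow ?P - 1) * c) = 0" for c :: "'p laurent"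
  proof (induction c rule: laurent_induct)
    case (add c d)
    then show ?case by (simp add: reduce_mod_def push_exponents_add distrib_left)
  next
    case (single k c)
    then show ?case
      by (simp add: reduce_mod_def left_diff_distrib mult_single push_exponents_diff)
  qed
  show ?thesis
  proof
    assume "reduce_mod m a = reduce_mod m b"
    then have "a - b = (a - reduce_mod m a) - (b - reduce_mod m b)" by simp
    then show "xpow ?P - 1 dvd a - b" using reduced by (metis dvd_diff)
  next
    assume "xpow ?P - 1 dvd a - b"
    then obtain c where "a - b = (xpow ?P - 1) * c" ..
    with zero[of c] have "reduce_mod m (a - b) = 0" by simp
    then show "reduce_mod m a = reduce_mod m b"
      by (simp add: reduce_mod_def push_exponents_diff)
  qed
qed

text \<open>Only an inclusion, because terms sent to the same exponent may cancel.\<close>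

lemma keys_push_exponents: "Poly_Mapping.keys (push_exponents f a) \<subseteq> f ` Poly_Mapping.keys a"
proof
  fix j
  assume "j \<in> Poly_Mapping.keys (push_exponents f a)"
  then have "(\<Sum>k\<in>Poly_Mapping.keys a. Poly_Mapping.lookup a k when f k = j) \<noteq> 0"
    by (simp add: in_keys_iff lookup_push_exponents)
  then obtain k where "k \<in> Poly_Mapping.keys a" "(Poly_Mapping.lookup a k when f k = j) \<noteq> 0"
    by (meson sum.not_neutral_contains_not_neutral)
  then show "j \<in> f ` Poly_Mapping.keys a" by (auto simp: when_def split: if_splits)
qed

lemma reduce_mod_in_group_algebra_mod: "reduce_mod m a \<in> group_algebra_mod m"
  using keys_push_exponents[of "\<lambda>k. k mod int CARD('a) ^ m" a]
  by (auto simp: group_algebra_mod_def reduce_mod_def dest!: subsetD)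

lemma reduce_mod_id:
  assumes "a \<in> group_algebra_mod m"
  shows "reduce_mod m a = a"
proof -
  have "reduce_mod m a = push_exponents (\<lambda>k. k) a"
    unfolding reduce_mod_def push_exponents_def using assms
    by (intro sum.cong) (auto simp: group_algebra_mod_def dest!: subsetD)
  then show ?thesis by simp
qed

lemma reduce_mod_Suc: "reduce_mod m (reduce_mod (Suc m) a) = reduce_mod m a"
  unfolding reduce_mod_def push_exponents_comp
  by (simp add: comp_def mod_mod_cancel)

lemma card_keys_subset:
  assumes "finite S"
  shows "card {a :: 'a \<Rightarrow>\<^sub>0 'b::{finite, zero}. Poly_Mapping.keys a \<subseteq> S} = CARD('b) ^ card S"
proof -
  have "bij_betw (\<lambda>a. restrict (Poly_Mapping.lookup a) S)
    {a :: 'a \<Rightarrow>\<^sub>0 'b. Poly_Mapping.keys a \<subseteq> S} (S \<rightarrow>\<^sub>E UNIV)"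
  proof (rule bij_betwI[where g = "\<lambda>f. Abs_poly_mapping (\<lambda>k. if k \<in> S then f k else 0)"])
    have lookup: "Poly_Mapping.lookup (Abs_poly_mapping (\<lambda>k. if k \<in> S then f k else 0)) =
      (\<lambda>k. if k \<in> S then f k else 0)" for f :: "'a \<Rightarrow> 'b"
      using assms by (intro lookup_Abs_poly_mapping) (simp add: rev_finite_subset[of S])
    show "(\<lambda>f. Abs_poly_mapping (\<lambda>k. if k \<in> S then f k else 0))
      \<in> (S \<rightarrow>\<^sub>E UNIV) \<rightarrow> {a :: 'a \<Rightarrow>\<^sub>0 'b. Poly_Mapping.keys a \<subseteq> S}"
      by (auto simp: in_keys_iff lookup split: if_splits)
    show "Abs_poly_mapping (\<lambda>k. if k \<in> S then restrict (Poly_Mapping.lookup a) S k else 0) = a"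
      if "a \<in> {a :: 'a \<Rightarrow>\<^sub>0 'b. Poly_Mapping.keys a \<subseteq> S}" for a
      using that by (intro poly_mapping_eqI) (auto simp: lookup in_keys_iff)
    show "restrict (Poly_Mapping.lookup (Abs_poly_mapping (\<lambda>k. if k \<in> S then f k else 0))) S = f"
      if "f \<in> S \<rightarrow>\<^sub>E (UNIV :: 'b set)" for f
      using that by (auto simp: lookup restrict_def PiE_def extensional_def fun_eq_iff)
  qed auto
  then show ?thesis using assms by (simp add: bij_betw_same_card card_PiE)
qed

lemma card_group_algebra_mod:
  "card (group_algebra_mod m :: ('p::prime_card) laurent set) = CARD('p) ^ (CARD('p) ^ m)"
proof -
  have "card {0..<int CARD('p) ^ m} = CARD('p) ^ m"
    by (simp add: nat_power_eq)
  then show ?thesis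
    unfolding group_algebra_mod_def by (subst card_keys_subset) simp_all
qed

section \<open>Divisible vectors\<close>

definition multiples :: "'a::comm_ring_1 \<Rightarrow> ('a ^ 'n::finite) set" where
  "multiples r = range (\<lambda>b. r *s b)"

lemma multiples_iff: "a \<in> multiples r \<longleftrightarrow> (\<forall>i. r dvd a $ i)"
proof
  assume "\<forall>i. r dvd a $ i"
  then have "\<forall>i. \<exists>c. a $ i = r * c" unfolding dvd_def .
  then obtain b where "\<And>i. a $ i = r * b i" by (auto dest!: choice)
  then have "a = r *s (\<chi> i. b i)" by (simp add: vec_eq_iff)
  then show "a \<in> multiples r" unfolding multiples_def by blast
next
  assume "a \<in> multiples r"
  then obtain b where "a = r *s b" unfolding multiples_def by blast
  then show "\<forall>i. r dvd a $ i" by simp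
qed

lemma multiples_zero [simp]: "0 \<in> multiples r"
  by (simp add: multiples_iff)

lemma multiples_add: "a \<in> multiples r \<Longrightarrow> b \<in> multiples r \<Longrightarrow> a + b \<in> multiples r"
  by (simp add: multiples_iff)

lemma multiples_diff: "a \<in> multiples r \<Longrightarrow> b \<in> multiples r \<Longrightarrow> a - b \<in> multiples r"
  by (simp add: multiples_iff)

lemma multiples_uminus: "a \<in> multiples r \<Longrightarrow> - a \<in> multiples r"
  by (simp add: multiples_iff)

lemma multiples_smult: "a \<in> multiples r \<Longrightarrow> c *s a \<in> multiples r"
  by (simp add: multiples_iff)

lemma smult_multiples: "r dvd c \<Longrightarrow> c *s a \<in> multiples r"
  by (simp add: multiples_iff)

lemma multiples_mono: "a \<in> multiples r \<Longrightarrow> q dvd r \<Longrightarrow> a \<in> multiples q"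
  by (auto simp: multiples_iff intro: dvd_trans)

text \<open>In a domain r^k can be cancelled from r^k r^l dividing r^k a. The indices record the
  price: removing the factor r^k loses k powers of r.\<close>

lemma multiples_power_cancel:
  fixes r :: "'a::idom"
  assumes "r ^ k *s a \<in> multiples (r ^ j)" and "r \<noteq> 0" and "k + l \<le> j"
  shows "a \<in> multiples (r ^ l)"
proof -
  have "r ^ k * r ^ l dvd r ^ k * a $ i" for i
    using assms(1,3) by (auto simp: multiples_iff simp flip: power_add intro: power_le_dvd)
  with assms(2) show ?thesis by (simp add: multiples_iff)
qed

section \<open>The pro-p topology\<close>

text \<open>The vector part of the subgroup N_m of the overview. The binomial form suits reduction
  of exponents; the power form in \<open>congruence_vectors_eq_power\<close> suits
  cancellation.\<close>

definition congruence_vectors :: "nat \<Rightarrow> ('p::prime_card, 'n::finite) lamp set" where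
  "congruence_vectors m = multiples (xpow (int CARD('p) ^ m) - 1)"

lemma congruence_vectors_eq_power:
  "congruence_vectors m
     = (multiples ((xpow 1 - 1) ^ (CARD('p) ^ m)) :: ('p::prime_card, 'n::finite) lamp set)"
  unfolding congruence_vectors_def xpow_minus_one_power by simp

lemma congruence_vectors_zero [simp]: "0 \<in> congruence_vectors m"
  by (simp add: congruence_vectors_def)

lemma congruence_vectors_add:
  "a \<in> congruence_vectors m \<Longrightarrow> b \<in> congruence_vectors m \<Longrightarrow> a + b \<in> congruence_vectors m"
  unfolding congruence_vectors_def by (rule multiples_add)

lemma congruence_vectors_diff:
  "a \<in> congruence_vectors m \<Longrightarrow> b \<in> congruence_vectors m \<Longrightarrow> a - b \<in> congruence_vectors m"
  unfolding congruence_vectors_def by (rule multiples_diff)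

lemma congruence_vectors_uminus: "a \<in> congruence_vectors m \<Longrightarrow> - a \<in> congruence_vectors m"
  unfolding congruence_vectors_def by (rule multiples_uminus)

lemma congruence_vectors_smult: "a \<in> congruence_vectors m \<Longrightarrow> c *s a \<in> congruence_vectors m"
  unfolding congruence_vectors_def by (rule multiples_smult)

lemma xpow_diff_smult_congruence_vectors:
  fixes a :: "('p::prime_card, 'n::finite) lamp"
  shows "int CARD('p) ^ m dvd j - k \<Longrightarrow> (xpow j - xpow k) *s a \<in> congruence_vectors m"
  unfolding congruence_vectors_def by (intro smult_multiples xpow_diff_dvd)

lemma congruence_vectors_antimono:
  fixes a :: "('p::prime_card, 'n::finite) lamp"
  assumes "a \<in> congruence_vectors l" and "m \<le> l"
  shows "a \<in> congruence_vectors m"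
proof -
  have "xpow (int CARD('p) ^ m) - 1 dvd (xpow (int CARD('p) ^ l) - 1 :: 'p laurent)"
    using assms(2) by (rule xpow_minus_one_dvd[OF le_imp_power_dvd])
  with assms(1) show ?thesis unfolding congruence_vectors_def by (rule multiples_mono)
qed

section \<open>Closure in the completed module as a system of congruences\<close>

lemma embed_lamp_eq_iff:
  fixes a b :: "('p::prime_card, 'n::finite) lamp"
  shows "(\<forall>i. embed_lamp a i m = embed_lamp b i m) \<longleftrightarrow> a - b \<in> congruence_vectors m"
  by (simp add: embed_lamp_def reduce_mod_eq_iff congruence_vectors_def multiples_iff)

lemma exists_power_CARD_ge: "\<exists>m. n \<le> CARD('p::prime_card) ^ m"
proof -
  have "1 < CARD('p)" by (metis prime_card prime_gt_1_nat)
  then have "n < CARD('p) ^ n" by (simp add: power_gt_expt)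
  then show ?thesis by (metis less_imp_le)
qed

text \<open>A monomial factor moves all exponents into the range from 0 to p^m - 1 for some large m.
  Such an element is its own reduction modulo p^m, and the divisibility makes this reduction
  zero.\<close>

lemma laurent_separated:
  fixes a :: "('p::prime_card) laurent"
  assumes "\<And>m. xpow (int CARD('p) ^ m) - 1 dvd a"
  shows "a = 0"
proof -
  obtain K where K: "\<And>k. k \<in> Poly_Mapping.keys a \<Longrightarrow> \<bar>k\<bar> \<le> int K"
  proof -
    have "finite ((\<lambda>k. nat \<bar>k\<bar>) ` Poly_Mapping.keys a)" by simp
    then obtain K where "\<forall>n \<in> (\<lambda>k. nat \<bar>k\<bar>) ` Poly_Mapping.keys a. n \<le> K"
      using finite_nat_set_iff_bounded_le by blast
    then show ?thesis by (intro that[of K]) auto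
  qed
  \<comment> \<open>The window from -K to K holds 2K + 1 exponents, and the shift by
    \<open>xpow (int K)\<close> makes it start at 0.\<close>
  obtain m where m: "2 * K + 1 \<le> CARD('p) ^ m" using exists_power_CARD_ge by blast
  let ?b = "xpow (int K) * a"
  have "Poly_Mapping.keys ?b \<subseteq> {0..<int CARD('p) ^ m}"
  proof
    fix j
    assume "j \<in> Poly_Mapping.keys ?b"
    then obtain k where "k \<in> Poly_Mapping.keys a" "j = int K + k"
      using keys_mult[of "xpow (int K)" a] by (auto split: if_splits)
    moreover have "2 * int K + 1 \<le> int CARD('p) ^ m"
      using m unfolding of_nat_power[symmetric] by linarith
    ultimately show "j \<in> {0..<int CARD('p) ^ m}" using K[of k] by auto
  qed
  then have "reduce_mod m ?b = ?b" by (intro reduce_mod_id) (simp add: group_algebra_mod_def)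
  moreover have "reduce_mod m ?b = reduce_mod m 0"
    unfolding reduce_mod_eq_iff using assms[of m] by simp
  ultimately have "xpow (int K) * a = 0" by (simp add: reduce_mod_def)
  then have "xpow (- int K) * (xpow (int K) * a) = 0" by simp
  then show ?thesis by (simp add: xpow_mult flip: mult.assoc)
qed

lemma inj_embed_lamp: "inj (embed_lamp :: ('p::prime_card, 'n::finite) lamp \<Rightarrow> _)"
proof
  fix a b :: "('p, 'n) lamp"
  assume "embed_lamp a = embed_lamp b"
  then have "a - b \<in> congruence_vectors m" for m by (simp flip: embed_lamp_eq_iff)
  then have "(a - b) $ i = 0" for i
    by (intro laurent_separated) (simp add: congruence_vectors_def multiples_iff)
  then show "a = b" by (simp add: vec_eq_iff)
qed

text \<open>The trace on the lamp configurations of the closure in the completion;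
  \<open>embed_lamp_in_closure_iff\<close> shows this, and afterwards the completion no longer
  appears.\<close>

definition vector_closure :: "('p::prime_card, 'n::finite) lamp set \<Rightarrow> ('p, 'n) lamp set" where
  "vector_closure U = {w. \<forall>m. \<exists>u\<in>U. w - u \<in> congruence_vectors m}"

lemma embed_lamp_in_topspace:
  "embed_lamp a \<in> topspace completed_lamp"
  by (auto simp: completed_lamp_def completed_algebra_def embed_lamp_def topspace_product_topology
      reduce_mod_in_group_algebra_mod reduce_mod_Suc)

lemma continuous_map_completed_lamp_eval:
  "continuous_map completed_lamp (discrete_topology (group_algebra_mod m)) (\<lambda>f. f i m)"
proof -
  have "continuous_map completed_algebra (discrete_topology (group_algebra_mod m)) (\<lambda>f. f m)"
    unfolding completed_algebra_def
    by (intro continuous_map_from_subtopology continuous_map_product_projection) simp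
  then have "continuous_map completed_lamp (discrete_topology (group_algebra_mod m))
    ((\<lambda>f. f m) \<circ> (\<lambda>f. f i))"
    unfolding completed_lamp_def
    by (rule continuous_map_compose[rotated]) (rule continuous_map_product_projection, simp)
  then show ?thesis by (simp add: comp_def)
qed

lemma embed_lamp_in_closure_iff:
  fixes U :: "('p::prime_card, 'n::finite) lamp set"
  shows "embed_lamp w \<in> Abstract_Topology.closure_of completed_lamp (embed_lamp ` U) \<longleftrightarrow> w \<in> vector_closure U"
proof
  assume w: "embed_lamp w \<in> Abstract_Topology.closure_of completed_lamp (embed_lamp ` U)"
  have "\<exists>u\<in>U. w - u \<in> congruence_vectors m" for m
  proof -
    \<comment> \<open>The index type \<open>'n\<close> is finite, so fixing the m-th component in
      every coordinate still gives an open set.\<close>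
    let ?T = "\<Inter>i. {f \<in> topspace completed_lamp. f i m \<in> {embed_lamp w i m}}"
    have "openin completed_lamp {f \<in> topspace completed_lamp. f i m \<in> {embed_lamp w i m}}" for i
      by (rule openin_continuous_map_preimage[OF continuous_map_completed_lamp_eval])
        (simp add: embed_lamp_def reduce_mod_in_group_algebra_mod)
    then have "openin completed_lamp ?T"
      by (intro openin_Inter) auto
    moreover have "embed_lamp w \<in> ?T" by (simp add: embed_lamp_in_topspace)
    ultimately obtain u where "u \<in> U" "embed_lamp u \<in> ?T"
      using w unfolding in_closure_of by blast
    then have "\<forall>i. embed_lamp w i m = embed_lamp u i m" by simp
    then show ?thesis using \<open>u \<in> U\<close> unfolding embed_lamp_eq_iff by blast
  qed
  then show "w \<in> vector_closure U" by (simp add: vector_closure_def)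
next
  assume "w \<in> vector_closure U"
  then have "\<forall>m. \<exists>u\<in>U. w - u \<in> congruence_vectors m" by (simp add: vector_closure_def)
  then obtain u where u: "\<And>m. u m \<in> U" "\<And>m. w - u m \<in> congruence_vectors m" by metis
  \<comment> \<open>A congruence at a deeper level implies the one at level m, so from index m on
    the approximants agree with w there. This gives convergence in every component.\<close>
  have eventually_eq: "\<forall>\<^sub>F c in sequentially. embed_lamp (u c) i m = embed_lamp w i m" for i m
  proof (rule eventually_sequentiallyI)
    fix c
    assume "m \<le> c"
    with u(2) have "w - u c \<in> congruence_vectors m" by (rule congruence_vectors_antimono)
    then show "embed_lamp (u c) i m = embed_lamp w i m" unfolding embed_lamp_eq_iff[symmetric] by simp
  qed
  have "limitin completed_lamp (\<lambda>m. embed_lamp (u m)) (embed_lamp w) sequentially"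
    unfolding completed_lamp_def limitin_componentwise
  proof (intro conjI ballI)
    show "\<forall>\<^sub>F m in sequentially. embed_lamp (u m) \<in> topspace (product_topology (\<lambda>_. completed_algebra) UNIV)"
      by (simp add: embed_lamp_in_topspace flip: completed_lamp_def)
    fix i :: 'n
    show "limitin completed_algebra (\<lambda>c. embed_lamp (u c) i) (embed_lamp w i) sequentially"
      unfolding completed_algebra_def limitin_subtopology limitin_componentwise
    proof (intro conjI ballI)
      fix m
      show "limitin (discrete_topology (group_algebra_mod m))
        (\<lambda>c. embed_lamp (u c) i m) (embed_lamp w i m) sequentially"
        unfolding limitin_def using eventually_eq[of i m]
        by (auto simp: embed_lamp_def reduce_mod_in_group_algebra_mod elim: eventually_mono)
    qed (auto simp: embed_lamp_def reduce_mod_Suc reduce_mod_in_group_algebra_mod PiE_UNIV_domain)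
  qed simp
  then show "embed_lamp w \<in> Abstract_Topology.closure_of completed_lamp (embed_lamp ` U)"
    unfolding limitin_def in_closure_of eventually_sequentially using u(1) by blast
qed

lemma vector_closure_subset: "U \<subseteq> vector_closure U"
  by (force simp: vector_closure_def)

lemma closed_in_completion_iff: "closed_in_completion U \<longleftrightarrow> vector_closure U \<subseteq> U"
proof -
  have "Abstract_Topology.closure_of completed_lamp (embed_lamp ` U) \<inter> range embed_lamp
    = embed_lamp ` vector_closure U"
    using embed_lamp_in_closure_iff[of _ U] by blast
  then have "closed_in_completion U \<longleftrightarrow> embed_lamp ` U = embed_lamp ` vector_closure U"
    by (simp add: closed_in_completion_def)
  also have "\<dots> \<longleftrightarrow> U = vector_closure U"
    by (rule inj_image_eq_iff[OF inj_embed_lamp])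
  also have "\<dots> \<longleftrightarrow> vector_closure U \<subseteq> U" using vector_closure_subset[of U] by blast
  finally show ?thesis .
qed

section \<open>Congruence subgroups as a base of the pro-p topology\<close>

lemma lamplighter_simps [simp]:
  "carrier lamplighter = UNIV"
  "\<one>\<^bsub>lamplighter\<^esub> = (0, 0)"
  "(a, j) \<otimes>\<^bsub>lamplighter\<^esub> (b, k) = (a + xpow j *s b, j + k)"
  by (simp_all add: lamplighter_def)

lemma inv_lamplighter [simp]: "inv\<^bsub>lamplighter\<^esub> (a, j) = (- (xpow (- j) *s a), - j)"
  by (rule group.inv_equality[OF group_lamplighter]) simp_all

text \<open>Lying in the same coset of N_m, put as two congruences without group operations;
  \<open>l_coset_congruence_subgroup\<close> justifies this.\<close>

definition lamp_cong :: "nat \<Rightarrow> ('p::prime_card, 'n::finite) lamp \<times> int \<Rightarrow> ('p, 'n) lamp \<times> int \<Rightarrow> bool" where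
  "lamp_cong m g h \<longleftrightarrow>
     fst g - fst h \<in> congruence_vectors m \<and> int CARD('p) ^ m dvd snd g - snd h"

definition congruence_subgroup :: "nat \<Rightarrow> (('p::prime_card, 'n::finite) lamp \<times> int) set" where
  "congruence_subgroup m = {g. lamp_cong m g (0, 0)}"

lemma congruence_subgroup_iff:
  "((a :: ('p::prime_card, 'n::finite) lamp), j) \<in> congruence_subgroup m
     \<longleftrightarrow> a \<in> congruence_vectors m \<and> int CARD('p) ^ m dvd j"
  by (simp add: congruence_subgroup_def lamp_cong_def)

lemma lamp_cong_refl [simp]: "lamp_cong m g g"
  by (simp add: lamp_cong_def)

lemma lamp_cong_antimono: "lamp_cong l g h \<Longrightarrow> m \<le> l \<Longrightarrow> lamp_cong m g h"
  unfolding lamp_cong_def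
  by (meson congruence_vectors_antimono dvd_trans le_imp_power_dvd)

lemma lamp_cong_sym: "lamp_cong m g h \<Longrightarrow> lamp_cong m h g"
  using congruence_vectors_uminus[of "fst g - fst h" m]
  by (auto simp: lamp_cong_def dvd_diff_commute)

lemma normal_congruence_subgroup:
  "(congruence_subgroup m :: (('p::prime_card, 'n::finite) lamp \<times> int) set) \<lhd> lamplighter"
proof -
  interpret group "lamplighter :: (('p, 'n) lamp \<times> int) monoid" by (rule group_lamplighter)
  have "subgroup (congruence_subgroup m :: (('p, 'n) lamp \<times> int) set) lamplighter"
  proof
    fix g h :: "('p, 'n) lamp \<times> int"
    assume "g \<in> congruence_subgroup m" "h \<in> congruence_subgroup m"
    then show "g \<otimes>\<^bsub>lamplighter\<^esub> h \<in> congruence_subgroup m"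
      by (cases g; cases h)
        (simp add: congruence_subgroup_iff congruence_vectors_add congruence_vectors_smult)
  next
    fix g :: "('p, 'n) lamp \<times> int"
    assume "g \<in> congruence_subgroup m"
    then show "inv\<^bsub>lamplighter\<^esub> g \<in> congruence_subgroup m"
      by (cases g)
        (simp add: congruence_subgroup_iff congruence_vectors_uminus congruence_vectors_smult)
  qed (auto simp: congruence_subgroup_iff)
  moreover have "g \<otimes>\<^bsub>lamplighter\<^esub> h \<otimes>\<^bsub>lamplighter\<^esub> inv\<^bsub>lamplighter\<^esub> g \<in> congruence_subgroup m"
    if "h \<in> congruence_subgroup m" for g h :: "('p, 'n) lamp \<times> int"
  proof -
    obtain a j where g: "g = (a, j)" by (cases g)
    obtain b k where h: "h = (b, k)" by (cases h)
    have b: "b \<in> congruence_vectors m" and k: "int CARD('p) ^ m dvd k"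
      using that by (simp_all add: h congruence_subgroup_iff)
    \<comment> \<open>Conjugating (b, k) by (a, j) gives the vector x^j b + (1 - x^k) a, and the
      second term is a congruence vector because p^m divides k.\<close>
    have "a + xpow j *s b - xpow (j + k) *s (xpow (- j) *s a)
      = (xpow 0 - xpow k) *s a + xpow j *s b"
      by (simp add: vec_eq_iff algebra_simps xpow_mult flip: mult.assoc)
    also have "\<dots> \<in> congruence_vectors m"
      using b k by (intro congruence_vectors_add congruence_vectors_smult
          xpow_diff_smult_congruence_vectors) simp_all
    finally show ?thesis using k
      by (simp add: g h congruence_subgroup_iff vector_smult_rneg)
  qed
  ultimately show ?thesis unfolding normal_inv_iff by blast
qed

text \<open>The factor x^j that the multiplication puts on the vector is a unit preserving the
  congruence vectors; the witness for the vector b is x^(-j) (b - a).\<close>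

lemma l_coset_congruence_subgroup:
  "g <#\<^bsub>lamplighter\<^esub> congruence_subgroup m = {h. lamp_cong m g h}"
proof -
  obtain a j where g: "g = (a, j)" by (cases g)
  have "h \<in> g <#\<^bsub>lamplighter\<^esub> congruence_subgroup m \<longleftrightarrow> lamp_cong m g h" for h
  proof -
    obtain b k where h: "h = (b, k)" by (cases h)
    have "h \<in> g <#\<^bsub>lamplighter\<^esub> congruence_subgroup m
      \<longleftrightarrow> (\<exists>c l. c \<in> congruence_vectors m \<and> int CARD('a) ^ m dvd l \<and> b = a + xpow j *s c \<and> k = j + l)"
      unfolding l_coset_def g h
      by (simp add: congruence_subgroup_iff Bex_def)
    also have "\<dots> \<longleftrightarrow> lamp_cong m h g"
    proof
      assume "lamp_cong m h g"
      then have "xpow (- j) *s (b - a) \<in> congruence_vectors m" "int CARD('a) ^ m dvd k - j"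
        by (simp_all only: lamp_cong_def g h fst_conv snd_conv congruence_vectors_smult)
      moreover have "b = a + xpow j *s (xpow (- j) *s (b - a))"
        by (simp add: vector_smult_assoc xpow_mult vector_smult_lid)
      ultimately show "\<exists>c l. c \<in> congruence_vectors m \<and> int CARD('a) ^ m dvd l \<and>
        b = a + xpow j *s c \<and> k = j + l"
        by (metis add_diff_cancel_left' add.commute diff_add_cancel)
    qed (auto simp: lamp_cong_def g h congruence_vectors_smult)
    finally show ?thesis by (blast intro: lamp_cong_sym)
  qed
  then show ?thesis by blast
qed

lemma r_coset_congruence_subgroup:
  "congruence_subgroup m #>\<^bsub>lamplighter\<^esub> g = {h. lamp_cong m g h}"
  using normal.coset_eq[OF normal_congruence_subgroup, of m] l_coset_congruence_subgroup[of g m]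
  by (metis lamplighter_simps(1) UNIV_I)

text \<open>Two functions with the same fibres have images in bijection. This serves to count cosets
  and, later, to define a map on a quotient through representatives.\<close>

lemma bij_betw_ranges:
  assumes "\<And>x y. f x = f y \<longleftrightarrow> g x = g y"
  shows "bij_betw (\<lambda>y. g (inv_into UNIV f y)) (range f) (range g)"
    and "g (inv_into UNIV f (f x)) = g x"
proof -
  show "bij_betw (\<lambda>y. g (inv_into UNIV f y)) (range f) (range g)"
    unfolding bij_betw_def
  proof
    show "inj_on (\<lambda>y. g (inv_into UNIV f y)) (range f)"
      by (intro inj_onI) (metis assms f_inv_into_f)
    show "(\<lambda>y. g (inv_into UNIV f y)) ` range f = range g"
      by (auto simp: image_iff) (metis assms f_inv_into_f rangeI)+
  qed
  show "g (inv_into UNIV f (f x)) = g x"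
    by (metis assms f_inv_into_f rangeI)
qed

lemma lamp_cong_iff_eq:
  fixes g h :: "('p::prime_card, 'n::finite) lamp \<times> int"
  shows "lamp_cong m g h \<longleftrightarrow>
    (\<lambda>i. embed_lamp (fst g) i m, snd g mod int CARD('p) ^ m)
      = (\<lambda>i. embed_lamp (fst h) i m, snd h mod int CARD('p) ^ m)"
  by (simp add: lamp_cong_def fun_eq_iff mod_eq_dvd_iff flip: embed_lamp_eq_iff)

text \<open>A coset is given by n elements of the group algebra of Z/p^m, each one of p^(p^m)
  possibilities, and a residue of the exponent modulo p^m.\<close>

lemma card_rcosets_congruence_subgroup:
  "card (rcosets\<^bsub>lamplighter\<^esub> (congruence_subgroup m :: (('p::prime_card, 'n::finite) lamp \<times> int) set))
     = CARD('p) ^ (CARD('p) ^ m * CARD('n) + m)"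
proof -
  let ?N = "congruence_subgroup m :: (('p, 'n) lamp \<times> int) set"
  let ?F = "\<lambda>g :: ('p, 'n) lamp \<times> int. (\<lambda>i. embed_lamp (fst g) i m, snd g mod int CARD('p) ^ m)"
  have "rcosets\<^bsub>lamplighter\<^esub> ?N = range (\<lambda>g. ?N #>\<^bsub>lamplighter\<^esub> g)"
    by (auto simp: RCOSETS_def)
  also have "card \<dots> = card (range ?F)"
  proof (rule bij_betw_same_card[OF bij_betw_ranges(1)])
    fix g h :: "('p, 'n) lamp \<times> int"
    show "?N #>\<^bsub>lamplighter\<^esub> g = ?N #>\<^bsub>lamplighter\<^esub> h \<longleftrightarrow> ?F g = ?F h"
      unfolding r_coset_congruence_subgroup lamp_cong_iff_eq by (auto simp: set_eq_iff)
  qed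
  also have "range ?F = (UNIV \<rightarrow>\<^sub>E group_algebra_mod m) \<times> {0..<int CARD('p) ^ m}"
  proof (intro equalityI subsetI)
    fix y :: "('n \<Rightarrow> 'p laurent) \<times> int"
    assume "y \<in> (UNIV \<rightarrow>\<^sub>E group_algebra_mod m) \<times> {0..<int CARD('p) ^ m}"
    then have "y = ?F (vec_lambda (fst y), snd y)"
      by (auto simp: embed_lamp_def fun_eq_iff reduce_mod_id PiE_def Pi_def)
    then show "y \<in> range ?F" by (rule image_eqI) simp
  qed (auto simp: embed_lamp_def reduce_mod_in_group_algebra_mod)
  also have "card \<dots> = (CARD('p) ^ (CARD('p) ^ m)) ^ CARD('n) * CARD('p) ^ m"
    by (simp add: card_cartesian_product card_PiE card_group_algebra_mod nat_power_eq)
  finally show ?thesis by (simp add: power_add power_mult)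
qed

lemma power_lamplighter: "(0, 1) [^]\<^bsub>lamplighter\<^esub> (k::nat) = (0, int k)"
  by (induction k) (simp_all add: nat_pow_def)

text \<open>In a quotient of order p^m the p^m-th power of (0, 1) is trivial, so (0, p^m) lies in N.
  Its commutators with the vectors (b, 0) give all (x^(p^m) - 1) b, and every element of N_m is a
  product of one such vector and a power of (0, p^m).\<close>

lemma congruence_subgroup_subset_normal:
  fixes N :: "(('p::prime_card, 'n::finite) lamp \<times> int) set"
  assumes N: "N \<lhd> lamplighter" and card: "card (rcosets\<^bsub>lamplighter\<^esub> N) = CARD('p) ^ m"
  shows "congruence_subgroup m \<subseteq> N"
proof -
  interpret normal N lamplighter by (rule N)
  interpret Q: group "lamplighter Mod N" by (rule factorgroup_is_group)
  have "(N #>\<^bsub>lamplighter\<^esub> (0, 1)) [^]\<^bsub>lamplighter Mod N\<^esub> CARD('p) ^ m = \<one>\<^bsub>lamplighter Mod N\<^esub>"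
    using Q.pow_order_eq_1[of "N #>\<^bsub>lamplighter\<^esub> (0, 1)"] card
    by (auto simp: order_def FactGroup_def RCOSETS_def)
  then have "N #>\<^bsub>lamplighter\<^esub> (0, int (CARD('p) ^ m)) = N"
    using FactGroup_pow[ of "(0, 1)" "CARD('p) ^ m"] by (simp add: power_lamplighter)
  then have shift: "(0, int (CARD('p) ^ m)) \<in> N"
    by (metis rcos_self[OF _ is_subgroup] lamplighter_simps(1) UNIV_I)
  have shifts: "(0, int (CARD('p) ^ m) * l) \<in> N" for l
  proof (induction l rule: int_induct[where k = 0])
    case base
    then show ?case using subgroup.one_closed[OF is_subgroup] by simp
  next
    case (step1 i)
    then show ?case using subgroup.m_closed[OF is_subgroup step1(2) shift] by (simp add: algebra_simps)
  next
    case (step2 i)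
    then show ?case using subgroup.m_closed[OF is_subgroup step2(2) subgroup.m_inv_closed[OF is_subgroup shift]] by (simp add: algebra_simps)
  qed
  have vectors: "((xpow (int CARD('p) ^ m) - 1) *s b, 0) \<in> N" for b
  proof -
    \<comment> \<open>With P = p^m this conjugate is (b - x^(-P) b, -P); multiplied on the left by
      (0, P) it becomes ((x^P - 1) b, 0).\<close>
    have "(b, 0) \<otimes>\<^bsub>lamplighter\<^esub> (inv\<^bsub>lamplighter\<^esub> (0, int (CARD('p) ^ m))) \<otimes>\<^bsub>lamplighter\<^esub> inv\<^bsub>lamplighter\<^esub> (b, 0) \<in> N"
      using subgroup.m_inv_closed[OF is_subgroup shift] by (intro inv_op_closed2) simp_all
    from subgroup.m_closed[OF is_subgroup shift this] show ?thesis
      by (simp add: vector_smult_rneg vector_add_ldistrib vector_smult_assoc xpow_mult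
          vector_smult_lid vector_sub_rdistrib)
  qed
  show ?thesis
  proof
    fix g :: "('p, 'n) lamp \<times> int"
    assume "g \<in> congruence_subgroup m"
    then obtain b l where "g = ((xpow (int CARD('p) ^ m) - 1) *s b, int (CARD('p) ^ m) * l)"
      by (cases g) (auto simp: congruence_subgroup_iff congruence_vectors_def multiples_def)
    then show "g \<in> N" using subgroup.m_closed[OF is_subgroup vectors[of b] shifts[of l]] by simp
  qed
qed

text \<open>From left to right this is an induction over the generation of the topology:
  intersections use the deeper of two levels, and a coset of N of index p^k can be recentred at any
  of its points and contains the coset of N_k there. Conversely the cosets of N_m are themselves
  generators.\<close>

lemma openin_pro_p_topology_iff:
  fixes S :: "(('p::prime_card, 'n::finite) lamp \<times> int) set"
  shows "openin (pro_p_topology CARD('p) lamplighter) S \<longleftrightarrow> (\<forall>g\<in>S. \<exists>m. {h. lamp_cong m g h} \<subseteq> S)"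
proof
  let ?\<B> = "{g <#\<^bsub>lamplighter\<^esub> N |g (N :: (('p, 'n) lamp \<times> int) set). g \<in> carrier lamplighter \<and>
    N \<lhd> lamplighter \<and> (\<exists>k. card (rcosets\<^bsub>lamplighter\<^esub> N) = CARD('p) ^ k)}"
  assume "openin (pro_p_topology CARD('p) lamplighter) S"
  then have "generate_topology_on ?\<B> S"
    by (simp add: pro_p_topology_def openin_topology_generated_by_iff)
  then show "\<forall>g\<in>S. \<exists>m. {h. lamp_cong m g h} \<subseteq> S"
  proof induction
    case (Int S T)
    show ?case
    proof
      fix g
      assume "g \<in> S \<inter> T"
      then obtain k l where "{h. lamp_cong k g h} \<subseteq> S" "{h. lamp_cong l g h} \<subseteq> T"
        using Int.IH by blast
      then have "{h. lamp_cong (max k l) g h} \<subseteq> S \<inter> T"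
        using lamp_cong_antimono[of "max k l" g _ k] lamp_cong_antimono[of "max k l" g _ l] by auto
      then show "\<exists>m. {h. lamp_cong m g h} \<subseteq> S \<inter> T" ..
    qed
  next
    case (Basis S)
    then obtain g k and N :: "(('p, 'n) lamp \<times> int) set"
      where S: "S = g <#\<^bsub>lamplighter\<^esub> N" and N: "N \<lhd> lamplighter"
      and k: "card (rcosets\<^bsub>lamplighter\<^esub> N) = CARD('p) ^ k" by blast
    interpret normal N lamplighter by (rule N)
    show ?case
    proof
      fix g'
      assume "g' \<in> S"
      then have "S = g' <#\<^bsub>lamplighter\<^esub> N"
        using l_repr_independence[of g' g N] S is_subgroup by simp
      moreover have "g' <#\<^bsub>lamplighter\<^esub> congruence_subgroup k \<subseteq> g' <#\<^bsub>lamplighter\<^esub> N"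
        using congruence_subgroup_subset_normal[OF N k] by (auto simp: l_coset_def)
      ultimately show "\<exists>m. {h. lamp_cong m g' h} \<subseteq> S"
        unfolding l_coset_congruence_subgroup by blast
    qed
  qed blast+
next
  assume S: "\<forall>g\<in>S. \<exists>m. {h. lamp_cong m g h} \<subseteq> S"
  have open_coset: "openin (pro_p_topology CARD('p) lamplighter) {h. lamp_cong m g h}"
    for m and g :: "('p, 'n) lamp \<times> int"
    unfolding pro_p_topology_def l_coset_congruence_subgroup[symmetric]
  proof (rule topology_generated_by_Basis, rule CollectI, intro exI conjI)
    show "g \<in> carrier lamplighter" by simp
  qed (rule refl normal_congruence_subgroup card_rcosets_congruence_subgroup)+
  show "openin (pro_p_topology CARD('p) lamplighter) S"
    by (subst openin_subopen) (metis S open_coset lamp_cong_refl mem_Collect_eq)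
qed

lemma topspace_pro_p_topology: "topspace (pro_p_topology CARD('p) lamplighter)
    = (UNIV :: (('p::prime_card, 'n::finite) lamp \<times> int) set)"
proof -
  have "openin (pro_p_topology CARD('p) lamplighter) (UNIV :: (('p, 'n) lamp \<times> int) set)"
    by (simp add: openin_pro_p_topology_iff)
  then show ?thesis using openin_subset by blast
qed

lemma closedin_pro_p_topology_iff:
  fixes S :: "(('p::prime_card, 'n::finite) lamp \<times> int) set"
  shows "closedin (pro_p_topology CARD('p) lamplighter) S \<longleftrightarrow>
    (\<forall>g. (\<forall>m. \<exists>h\<in>S. lamp_cong m g h) \<longrightarrow> g \<in> S)"
  unfolding closedin_def topspace_pro_p_topology openin_pro_p_topology_iff by blast

section \<open>Laurent polynomials as fractions of polynomials\<close>

lemma lookup_laurent_of_poly: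
  "Poly_Mapping.lookup (laurent_of_poly q) k = (if 0 \<le> k then poly.coeff q (nat k) else 0)"
proof -
  have "Poly_Mapping.lookup (laurent_of_poly q) k
    = (\<Sum>i\<le>degree q. if i = nat k \<and> 0 \<le> k then poly.coeff q i else 0)"
    unfolding laurent_of_poly_def lookup_sum lookup_single when_def
    by (intro sum.cong) auto
  also have "\<dots> = (if 0 \<le> k then poly.coeff q (nat k) else 0)"
    by (auto simp: coeff_eq_0)
  finally show ?thesis .
qed

lemma laurent_of_poly_add: "laurent_of_poly (p + q) = laurent_of_poly p + laurent_of_poly q"
  by (rule poly_mapping_eqI) (simp add: lookup_laurent_of_poly lookup_add)

lemma laurent_of_poly_monom [simp]:
  "laurent_of_poly (Polynomial.monom c n) = Poly_Mapping.single (int n) c"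
  by (rule poly_mapping_eqI) (auto simp: lookup_laurent_of_poly lookup_single when_def)

lemma laurent_of_poly_0 [simp]: "laurent_of_poly 0 = 0"
  by (rule poly_mapping_eqI) (simp add: lookup_laurent_of_poly)

lemma laurent_of_poly_1 [simp]: "laurent_of_poly 1 = 1"
  using laurent_of_poly_monom[of 1 0] by (simp del: laurent_of_poly_monom)

lemma lookup_single_mult:
  fixes a :: "('p::prime_card) laurent"
  shows "Poly_Mapping.lookup (Poly_Mapping.single j c * a) k = c * Poly_Mapping.lookup a (k - j)"
proof (induction a rule: laurent_induct)
  case (single i d)
  then show ?case by (auto simp: mult_single lookup_single when_def)
qed (simp add: lookup_add distrib_left)

lemma laurent_of_poly_smult:
  "laurent_of_poly (Polynomial.smult c q) = Poly_Mapping.single 0 c * laurent_of_poly q"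
  by (rule poly_mapping_eqI) (simp add: lookup_laurent_of_poly lookup_single_mult)

lemma laurent_of_poly_pCons_0: "laurent_of_poly (pCons 0 q) = xpow 1 * laurent_of_poly q"
  by (rule poly_mapping_eqI)
    (auto simp: lookup_laurent_of_poly lookup_single_mult coeff_pCons nat_diff_distrib
      split: nat.split)

lemma laurent_of_poly_mult: "laurent_of_poly (p * q) = laurent_of_poly p * laurent_of_poly q"
proof (induction p)
  case (pCons a p)
  have "laurent_of_poly (pCons a p) = laurent_of_poly (Polynomial.monom a 0 + pCons 0 p)"
    by (simp add: Polynomial.monom_0)
  also have "\<dots> = Poly_Mapping.single 0 a + xpow 1 * laurent_of_poly p"
    by (simp add: laurent_of_poly_add laurent_of_poly_pCons_0)
  finally show ?case using pCons
    by (simp add: laurent_of_poly_add laurent_of_poly_smult laurent_of_poly_pCons_0 distrib_right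
        mult.assoc)
qed simp

lemma laurent_of_poly_power: "laurent_of_poly (q ^ r) = laurent_of_poly q ^ r"
  by (induction r) (simp_all add: laurent_of_poly_mult)

lemma laurent_of_poly_eq_iff [simp]: "laurent_of_poly p = laurent_of_poly q \<longleftrightarrow> p = q"
proof
  assume eq: "laurent_of_poly p = laurent_of_poly q"
  have "poly.coeff p n = poly.coeff q n" for n
    using arg_cong[OF eq, of "\<lambda>a. Poly_Mapping.lookup a (int n)"]
    by (simp add: lookup_laurent_of_poly)
  then show "p = q" by (rule poly_eqI)
qed simp

lemma xpow_mult_cancel [simp]: "xpow (- k) * (xpow k * a) = a" "xpow k * (xpow (- k) * a) = a"
  by (simp_all add: xpow_mult flip: mult.assoc)

text \<open>A monomial clears the negative exponents. The induction keeps its exponent a natural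
  number, so that K + L serves as common denominator of a sum.\<close>

lemma laurent_eq_xpow_mult_poly:
  fixes a :: "('p::prime_card) laurent"
  obtains k q where "a = xpow k * laurent_of_poly q"
proof -
  have "\<exists>K q. xpow (int K) * a = laurent_of_poly q"
  proof (induction a rule: laurent_induct)
    case (add a b)
    then obtain K L p q where a: "xpow (int K) * a = laurent_of_poly p"
      and b: "xpow (int L) * b = laurent_of_poly q" by blast
    have "xpow (int (K + L)) * (a + b) = xpow (int L) * (xpow (int K) * a) + xpow (int K) * (xpow (int L) * b)"
      by (simp add: distrib_left xpow_mult add.commute flip: mult.assoc)
    also have "\<dots> = laurent_of_poly (Polynomial.monom 1 L * p + Polynomial.monom 1 K * q)"
      by (simp add: a b laurent_of_poly_add laurent_of_poly_mult)
    finally show ?case by blast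
  next
    case (single k c)
    have "xpow (int (nat (- k))) * Poly_Mapping.single k c
      = laurent_of_poly (Polynomial.monom c (nat k))"
      by (cases "k \<ge> 0") (simp_all add: mult_single)
    then show ?case by blast
  qed
  then obtain K q where q: "xpow (int K) * a = laurent_of_poly q" by blast
  then have "a = xpow (- int K) * laurent_of_poly q" by (metis xpow_mult_cancel(1))
  then show ?thesis by (rule that)
qed

text \<open>The Euclidean norm on R. A numerator is determined only up to powers of x, so its degree
  is minimised over all choices.\<close>

definition laurent_size :: "('p::prime_card) laurent \<Rightarrow> nat" where
  "laurent_size a = (LEAST n. \<exists>k q. a = xpow k * laurent_of_poly q \<and> degree q = n)"

text \<open>Polynomial division of the numerators, with a numerator of b that attains the minimal
  degree. The remainder has a numerator of smaller degree, and its size is at most that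
  degree.\<close>

lemma laurent_division:
  fixes a b :: "('p::prime_card) laurent"
  assumes "b \<noteq> 0"
  shows "\<exists>q r. a = q * b + r \<and> (r = 0 \<or> laurent_size r < laurent_size b)"
proof -
  obtain k f where a: "a = xpow k * laurent_of_poly f" by (rule laurent_eq_xpow_mult_poly)
  obtain l' g' where "b = xpow l' * laurent_of_poly g'" by (rule laurent_eq_xpow_mult_poly)
  then have "\<exists>n l g. b = xpow l * laurent_of_poly g \<and> degree g = n" by blast
  from LeastI_ex[OF this] obtain l g where b: "b = xpow l * laurent_of_poly g"
    and g: "degree g = laurent_size b" unfolding laurent_size_def by blast
  have "g \<noteq> 0" using assms b by auto
  have "a = xpow k * laurent_of_poly (f div g * g + f mod g)" by (simp add: a)
  also have "\<dots> = xpow k * laurent_of_poly (f div g) * laurent_of_poly g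
      + xpow k * laurent_of_poly (f mod g)"
    by (simp only: laurent_of_poly_add laurent_of_poly_mult distrib_left mult.assoc)
  also have "laurent_of_poly g = xpow (- l) * b" by (simp add: b)
  finally have "a = (xpow k * laurent_of_poly (f div g) * xpow (- l)) * b
      + xpow k * laurent_of_poly (f mod g)" by (simp add: mult.assoc)
  moreover have "f mod g = 0 \<or> degree (f mod g) < degree g"
    using \<open>g \<noteq> 0\<close> by (rule degree_mod_less)
  moreover have "laurent_size (xpow k * laurent_of_poly (f mod g)) \<le> degree (f mod g)"
    unfolding laurent_size_def by (rule Least_le) blast
  ultimately show ?thesis unfolding g
    by (intro exI[of _ "xpow k * laurent_of_poly (f div g) * xpow (- l)"]
        exI[of _ "xpow k * laurent_of_poly (f mod g)"]) (auto simp: le_less_trans)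
qed

section \<open>Submodules of free modules over a Euclidean ring\<close>

text \<open>Vectors of length N are functions on all natural numbers, with vanishing from N on as a
  separate hypothesis, so that the rank can change in an induction without a change of type.\<close>

definition function_submodule :: "(nat \<Rightarrow> 'a::comm_ring_1) set \<Rightarrow> bool" where
  "function_submodule U \<longleftrightarrow> U \<noteq> {} \<and> (\<forall>f\<in>U. \<forall>g\<in>U. \<forall>c. (\<lambda>i. f i + c * g i) \<in> U)"

text \<open>An invertible N x N matrix extended by the identity. The last two conditions express the
  block form: coordinates from N on stay fixed, and the first N images depend on the first N entries
  only.\<close>

definition coordinate_change :: "nat \<Rightarrow> ((nat \<Rightarrow> 'a::comm_ring_1) \<Rightarrow> nat \<Rightarrow> 'a) \<Rightarrow> bool" where
  "coordinate_change N \<phi> \<longleftrightarrow> bij \<phi> \<and> (\<forall>f g c. \<phi> (\<lambda>i. f i + c * g i) = (\<lambda>i. \<phi> f i + c * \<phi> g i)) \<and>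
     (\<forall>f. \<forall>i\<ge>N. \<phi> f i = f i) \<and>
     (\<forall>f g. (\<forall>i<N. f i = g i) \<longrightarrow> (\<forall>i<N. \<phi> f i = \<phi> g i))"

lemma coordinate_change_id: "coordinate_change N (\<lambda>f. f)"
  by (simp add: coordinate_change_def flip: id_def)

lemma coordinate_change_mono:
  assumes "coordinate_change N \<phi>" and "N \<le> M"
  shows "coordinate_change M \<phi>"
  unfolding coordinate_change_def
proof (intro conjI allI impI)
  fix f g :: "nat \<Rightarrow> 'a" and i
  assume "\<forall>i<M. f i = g i" "i < M"
  then show "\<phi> f i = \<phi> g i"
    using assms by (cases "i < N") (auto simp: coordinate_change_def)
qed (use assms in \<open>auto simp: coordinate_change_def\<close>)

lemma coordinate_change_comp:
  assumes "coordinate_change N \<phi>" and "coordinate_change N \<psi>"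
  shows "coordinate_change N (\<lambda>f. \<phi> (\<psi> f))"
  using assms bij_comp[of \<psi> \<phi>] unfolding coordinate_change_def comp_def by auto

lemma coordinate_changeI:
  assumes "\<And>f. \<theta> (\<phi> f) = f" and "\<And>f. \<phi> (\<theta> f) = f"
    and "\<And>f g c. \<phi> (\<lambda>i. f i + c * g i) = (\<lambda>i. \<phi> f i + c * \<phi> g i)"
    and "\<And>f i. i \<ge> N \<Longrightarrow> \<phi> f i = f i"
    and "\<And>f g i. (\<And>i. i < N \<Longrightarrow> f i = g i) \<Longrightarrow> i < N \<Longrightarrow> \<phi> f i = \<phi> g i"
  shows "coordinate_change N \<phi>"
proof -
  have "bij \<phi>" using assms(1,2) by (intro o_bij[of \<theta>]) (simp_all add: fun_eq_iff)
  then show ?thesis unfolding coordinate_change_def using assms(3-5) by blast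
qed

text \<open>One step of the Euclidean algorithm between the coordinates j and N, with the remainder
  moved into position N.\<close>

lemma coordinate_change_reduce_swap:
  assumes "j < N"
  shows "coordinate_change (Suc N) (\<lambda>f i. if i = N then f j - q * f N else if i = j then f N else f i)"
  by (rule coordinate_changeI[where \<theta> = "\<lambda>f i. if i = N then f j else if i = j then f N + q * f j else f i"])
    (use assms in \<open>auto simp: fun_eq_iff algebra_simps\<close>)

lemma coordinate_change_eliminate:
  "coordinate_change (Suc N) (\<lambda>f i. if i < N then f i - k i * f N else f i)"
  by (rule coordinate_changeI[where \<theta> = "\<lambda>f i. if i < N then f i + k i * f N else f i"])
    (auto simp: fun_eq_iff algebra_simps)

text \<open>Diagonalisation of a submodule of a free module. A nonzero last coordinate of minimal
  size divides the other coordinates of its vector and the last coordinate of every element of U;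
  eliminating with it splits off one cyclic part and lowers the rank.\<close>

lemma submodule_coordinates:
  fixes size :: "'a::comm_ring_1 \<Rightarrow> nat" and U :: "(nat \<Rightarrow> 'a) set"
  assumes division: "\<And>a b. b \<noteq> 0 \<Longrightarrow> \<exists>q r. a = q * b + r \<and> (r = 0 \<or> size r < size b)"
    and "function_submodule U" and "\<And>u i. u \<in> U \<Longrightarrow> i \<ge> N \<Longrightarrow> u i = 0"
  shows "\<exists>\<phi> d. coordinate_change N \<phi> \<and>
    (\<forall>u. (\<forall>i\<ge>N. u i = 0) \<longrightarrow> (u \<in> U \<longleftrightarrow> (\<forall>i<N. d i dvd \<phi> u i)))"
  using assms(2,3)
proof (induction N arbitrary: U)
  case 0
  then obtain u where "u \<in> U" by (auto simp: function_submodule_def)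
  moreover have "u = w" if "\<forall>i. w i = 0" for w using that 0(2)[OF \<open>u \<in> U\<close>] by auto
  ultimately show ?case using coordinate_change_id[of 0] by auto
next
  case (Suc N)
  have combination: "(\<lambda>i. f i + c * g i) \<in> U" if "f \<in> U" "g \<in> U" for f g c
    using Suc.prems(1) that by (simp add: function_submodule_def)
  show ?case
  proof (cases "\<forall>u\<in>U. u N = 0")
    case True
    have "u i = 0" if "u \<in> U" "i \<ge> N" for u i
      using that True Suc.prems(2)[of u i] by (cases "i = N") auto
    with Suc.IH[of U] Suc.prems(1) obtain \<phi> d where \<phi>: "coordinate_change N \<phi>"
      and d: "\<And>u. \<forall>i\<ge>N. u i = 0 \<Longrightarrow> u \<in> U \<longleftrightarrow> (\<forall>i<N. d i dvd \<phi> u i)" by metis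
    \<comment> \<open>The divisor 0 forces the last coordinate to vanish; it stands for a free
      summand of the quotient.\<close>
    have "u \<in> U \<longleftrightarrow> (\<forall>i<Suc N. (d(N := 0)) i dvd \<phi> u i)" if u: "\<forall>i\<ge>Suc N. u i = 0" for u
    proof -
      have "\<phi> u N = u N" using \<phi> by (simp add: coordinate_change_def)
      moreover have "u \<in> U \<longleftrightarrow> (\<forall>i<N. d i dvd \<phi> u i)" if "u N = 0"
      proof (rule d, intro allI impI)
        fix i
        assume "N \<le> i"
        then show "u i = 0" using that u by (cases "i = N") auto
      qed
      ultimately show ?thesis using True by (auto simp: less_Suc_eq)
    qed
    moreover have "coordinate_change (Suc N) \<phi>" using \<phi> by (rule coordinate_change_mono) simp
    ultimately show ?thesis by blast
  next
    case False
    \<comment> \<open>The minimum is taken over coordinate systems as well as vectors, so that a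
      remainder in any position can compete after a swap into position N.\<close>
    let ?P = "\<lambda>\<phi> u. coordinate_change (Suc N) \<phi> \<and> u \<in> U \<and> \<phi> u N \<noteq> 0"
    have "\<exists>x. case x of (\<phi>, u) \<Rightarrow> ?P \<phi> u" using False coordinate_change_id[of "Suc N"] by auto
    from ex_has_least_nat[of "\<lambda>(\<phi>, u). ?P \<phi> u", OF this[THEN someI_ex], of "\<lambda>(\<phi>, u). size (\<phi> u N)"]
    obtain \<phi> u where \<phi>: "coordinate_change (Suc N) \<phi>" and u: "u \<in> U" and nz: "\<phi> u N \<noteq> 0"
      and minimal: "\<And>\<psi> w. ?P \<psi> w \<Longrightarrow> size (\<phi> u N) \<le> size (\<psi> w N)"
      by auto
    define d where "d = \<phi> u N"
    have \<phi>_linear: "\<phi> (\<lambda>i. f i + c * g i) = (\<lambda>i. \<phi> f i + c * \<phi> g i)" for f g c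
      using \<phi> by (simp add: coordinate_change_def)
    have "\<exists>k. \<phi> u j = d * k" if "j < N" for j
    proof -
      obtain q r where qr: "\<phi> u j = q * d + r" "r = 0 \<or> size r < size d"
        using division[of d] nz unfolding d_def by blast
      define \<psi> where
        "\<psi> f = (\<lambda>i. if i = N then \<phi> f j - q * \<phi> f N else if i = j then \<phi> f N else \<phi> f i)" for f
      have "coordinate_change (Suc N) \<psi>"
        unfolding \<psi>_def using coordinate_change_comp[OF coordinate_change_reduce_swap[OF that] \<phi>, of q] .
      moreover have "\<psi> u N = r" using qr by (simp add: \<psi>_def d_def)
      ultimately have "r = 0" using minimal[of \<psi> u] u qr(2) unfolding d_def by force
      then show ?thesis using qr by (auto simp: mult.commute)
    qed
    then obtain k where k: "\<And>j. j < N \<Longrightarrow> \<phi> u j = d * k j" by metis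
    have d_dvd: "d dvd \<phi> w N" if "w \<in> U" for w
    proof -
      obtain q r where qr: "\<phi> w N = q * d + r" "r = 0 \<or> size r < size d"
        using division[of d] nz unfolding d_def by blast
      define w' where "w' = (\<lambda>i. w i + (- q) * u i)"
      have "\<phi> w' N = r" using qr unfolding w'_def \<phi>_linear by (simp add: d_def)
      moreover have "w' \<in> U" unfolding w'_def using that u by (rule combination)
      ultimately have "r = 0" using minimal[of \<phi> w'] \<phi> qr(2) unfolding d_def by force
      then show ?thesis using qr by simp
    qed
    define \<psi> where "\<psi> f = (\<lambda>i. if i < N then \<phi> f i - k i * \<phi> f N else \<phi> f i)" for f
    have \<psi>: "coordinate_change (Suc N) \<psi>"
      unfolding \<psi>_def using coordinate_change_comp[OF coordinate_change_eliminate \<phi>] .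
    then have inj: "inj \<psi>" and linear: "\<psi> (\<lambda>i. f i + c * g i) = (\<lambda>i. \<psi> f i + c * \<psi> g i)"
      and fixed: "i \<ge> Suc N \<Longrightarrow> \<psi> f i = f i" for f g c i
      by (simp_all add: coordinate_change_def bij_is_inj)
    have \<psi>_u: "\<psi> u N = d" "\<And>i. i < N \<Longrightarrow> \<psi> u i = 0"
      using k by (simp_all add: \<psi>_def d_def mult.commute)
    \<comment> \<open>Now \<open>\<psi> u\<close> is d times the last basis vector, so U is spanned
      by u and its elements with last coordinate 0, to which the induction hypothesis
      applies.\<close>
    define U' where "U' = {\<psi> w |w. w \<in> U \<and> \<psi> w N = 0}"
    have "function_submodule U'"
      unfolding function_submodule_def
    proof (intro conjI ballI allI)
      have "\<psi> (\<lambda>i. u i + (- 1) * u i) N = 0" unfolding linear by simp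
      then show "U' \<noteq> {}" using combination[OF u u, of "- 1"] unfolding U'_def by blast
      fix f g c
      assume "f \<in> U'" "g \<in> U'"
      then obtain v w where "f = \<psi> v" "g = \<psi> w" "v \<in> U" "w \<in> U" "\<psi> v N = 0" "\<psi> w N = 0"
        unfolding U'_def by blast
      then show "(\<lambda>i. f i + c * g i) \<in> U'"
        unfolding U'_def using combination[of v w c] linear[of v c w] by force
    qed
    moreover have "f i = 0" if "f \<in> U'" "i \<ge> N" for f i
      using that fixed[of i] Suc.prems(2)[of _ i] unfolding U'_def by (cases "i = N") auto
    ultimately obtain \<theta> d' where \<theta>: "coordinate_change N \<theta>"
      and d': "\<And>f. \<forall>i\<ge>N. f i = 0 \<Longrightarrow> f \<in> U' \<longleftrightarrow> (\<forall>i<N. d' i dvd \<theta> f i)"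
      using Suc.IH[of U'] by metis
    have "w \<in> U \<longleftrightarrow> (\<forall>i<Suc N. (d'(N := d)) i dvd \<theta> (\<psi> w) i)" if w: "\<forall>i\<ge>Suc N. w i = 0" for w
    proof -
      have \<theta>_N: "\<theta> (\<psi> w) N = \<psi> w N" using \<theta> by (simp add: coordinate_change_def)
      have \<psi>_N: "\<psi> w N = \<phi> w N" by (simp add: \<psi>_def)
      show ?thesis
      proof (cases "d dvd \<psi> w N")
        case False
        then show ?thesis using d_dvd[of w] \<theta>_N \<psi>_N by auto
      next
        case True
        then obtain a where a: "\<psi> w N = d * a" ..
        \<comment> \<open>Subtracting a u clears the last new coordinate of w and leaves the earlier
          ones unchanged.\<close>
        let ?v = "\<lambda>i. w i + (- a) * u i"
        have v_N: "\<psi> ?v N = 0" unfolding linear by (simp add: a \<psi>_u)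
        have "\<psi> ?v i = 0" if "i \<ge> N" for i
          using that v_N fixed[of i ?v] w Suc.prems(2)[OF u, of i] by (cases "i = N") auto
        then have "\<psi> ?v \<in> U' \<longleftrightarrow> (\<forall>i<N. d' i dvd \<theta> (\<psi> ?v) i)" by (intro d') simp
        moreover have "\<theta> (\<psi> ?v) i = \<theta> (\<psi> w) i" if "i < N" for i
        proof -
          have "\<forall>i<N. \<psi> ?v i = \<psi> w i" unfolding linear using \<psi>_u by simp
          with \<theta> that show ?thesis unfolding coordinate_change_def by blast
        qed
        moreover have "\<psi> ?v \<in> U' \<longleftrightarrow> ?v \<in> U"
          using v_N inj unfolding U'_def by (auto dest: injD)
        moreover have "?v \<in> U \<longleftrightarrow> w \<in> U"
          using combination[of w u "- a"] combination[of ?v u a] u by auto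
        ultimately show ?thesis using True \<theta>_N by (auto simp: less_Suc_eq)
      qed
    qed
    moreover have "coordinate_change (Suc N) (\<lambda>f. \<theta> (\<psi> f))"
      using coordinate_change_comp[OF coordinate_change_mono[OF \<theta>] \<psi>] by simp
    ultimately show ?thesis by blast
  qed
qed

section \<open>Cyclic decompositions in coordinates\<close>

lemma dvd_diff_swap: "(a :: 'a::comm_ring_1) dvd b - c \<longleftrightarrow> a dvd c - b"
  by (metis dvd_minus_iff minus_diff_eq)

definition coset_of :: "'m::ab_group_add set \<Rightarrow> 'm \<Rightarrow> 'm set" where
  "coset_of U x = {y. y - x \<in> U}"

lemma quotient_laurent_module:
  fixes act :: "('p::prime_card) laurent \<Rightarrow> 'm \<Rightarrow> 'm::ab_group_add"
  assumes "Modules.module act" and "Modules.module.subspace act U"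
  shows "coset_of U x = coset_of U y \<longleftrightarrow> x - y \<in> U"
    and "carrier (quotient_module (laurent_module act) U) = range (coset_of U)"
    and "coset_of U x \<oplus>\<^bsub>quotient_module (laurent_module act) U\<^esub> coset_of U y = coset_of U (x + y)"
    and "r \<odot>\<^bsub>quotient_module (laurent_module act) U\<^esub> coset_of U x = coset_of U (act r x)"
proof -
  interpret Modules.module act by fact
  note subspace = subspace_0[OF assms(2)] subspace_add[OF assms(2)] subspace_diff[OF assms(2)]
    subspace_neg[OF assms(2)] subspace_scale[OF assms(2)]
  have coset': "(\<Union>u\<in>U. {u + x}) = coset_of U x" for x
    by (force simp: coset_of_def)
  have coset: "U +>\<^bsub>laurent_module act\<^esub> x = coset_of U x" for x
    by (simp add: a_r_coset_def' laurent_module_def coset')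
  show eq: "coset_of U x = coset_of U y \<longleftrightarrow> x - y \<in> U" for x y
  proof
    assume "coset_of U x = coset_of U y"
    moreover have "x \<in> coset_of U x" using subspace(1) by (simp add: coset_of_def)
    ultimately show "x - y \<in> U" by (simp add: coset_of_def)
  next
    assume "x - y \<in> U"
    then have "z - x \<in> U \<longleftrightarrow> z - y \<in> U" for z
      using subspace(2)[of "z - x" "x - y"] subspace(3)[of "z - y" "x - y"] by auto
    then show "coset_of U x = coset_of U y" by (simp add: coset_of_def)
  qed
  show "carrier (quotient_module (laurent_module act) U) = range (coset_of U)"
  proof -
    have "carrier (laurent_module act) = UNIV" by (simp add: laurent_module_def)
    then show ?thesis by (auto simp: quotient_module_def A_RCOSETS_def' coset)
  qed
  show "coset_of U x \<oplus>\<^bsub>quotient_module (laurent_module act) U\<^esub> coset_of U y = coset_of U (x + y)"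
  proof -
    have "\<exists>a b. a - x \<in> U \<and> b - y \<in> U \<and> z = a + b" if "z - (x + y) \<in> U" for z
      using that subspace(1) by (intro exI[of _ x] exI[of _ "z - x"]) (simp add: algebra_simps)
    moreover have "a + b - (x + y) \<in> U" if "a - x \<in> U" "b - y \<in> U" for a b
      using subspace(2)[OF that] by (simp add: algebra_simps)
    ultimately show ?thesis
      by (auto simp: quotient_module_def set_add_def' laurent_module_def coset_of_def)
  qed
  show "r \<odot>\<^bsub>quotient_module (laurent_module act) U\<^esub> coset_of U x = coset_of U (act r x)"
  proof -
    have "coset_of U (act r y) = coset_of U (act r x)" if "y \<in> coset_of U x" for y
      using that subspace(5)[of "y - x" r] unfolding eq by (simp add: coset_of_def scale_right_diff_distrib)
    moreover have "x \<in> coset_of U x" using subspace(1) by (simp add: coset_of_def)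
    ultimately have "(\<Union>y\<in>coset_of U x. coset_of U (act r y)) = coset_of U (act r x)" by blast
    moreover have "r \<odot>\<^bsub>laurent_module act\<^esub> y = act r y" for y by (simp add: laurent_module_def)
    ultimately show ?thesis by (simp add: quotient_module_def coset)
  qed
qed

text \<open>Each pair \<open>(d, c)\<close> in the list is a summand \<open>R/dR\<close> together with the corresponding
  coordinate function, which needs to be linear only modulo \<open>d\<close>.\<close>

definition cyclic_coordinates ::
    "('r::comm_ring_1 \<Rightarrow> 'm \<Rightarrow> 'm) \<Rightarrow> 'm::ab_group_add set \<Rightarrow> ('r \<times> ('m \<Rightarrow> 'r)) list \<Rightarrow> bool" where
  "cyclic_coordinates act U L \<longleftrightarrow>
     (\<forall>(d, c)\<in>set L. (\<forall>a b. d dvd c (a + b) - (c a + c b)) \<and> (\<forall>r a. d dvd c (act r a) - r * c a)) \<and>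
     (\<forall>u. u \<in> U \<longleftrightarrow> (\<forall>(d, c)\<in>set L. d dvd c u)) \<and>
     (\<forall>gs. length gs = length L \<longrightarrow> (\<exists>a. list_all2 (\<lambda>(d, c) g. d dvd c a - g) L gs))"

lemma module_mult: "Modules.module ((*) :: 'a::comm_ring_1 \<Rightarrow> _)"
  by unfold_locales (simp_all add: algebra_simps)

lemma subspace_multiples_of: "Modules.module.subspace (*) {b :: 'a::comm_ring_1. d dvd b}"
  by (simp add: Modules.module.subspace_def[OF module_mult])

lemma cyclic_module_eq: "cyclic_module q r = quotient_module (laurent_module (*)) {b. laurent_of_poly q ^ r dvd b}"
proof -
  have "range (\<lambda>a. laurent_of_poly q ^ r * a) = {b. laurent_of_poly q ^ r dvd b}"
    by (auto simp: dvd_def)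
  then show ?thesis by (simp add: cyclic_module_def)
qed

text \<open>Coordinates give the map to the tuple of their cosets; its kernel is U and the lifting
  clause makes it onto. Conversely, representatives of the components of an isomorphism are
  coordinates. As they are chosen freely, they are linear only modulo \<open>D i\<close>.\<close>

lemma module_isomorphic_direct_sum_iff:
  fixes act :: "('p::prime_card) laurent \<Rightarrow> 'm \<Rightarrow> 'm::ab_group_add"
  assumes act: "Modules.module act" and U: "Modules.module.subspace act U"
  shows "module_isomorphic (quotient_module (laurent_module act) U)
      (direct_sum_module (map (\<lambda>(q, r). cyclic_module q r) qs)) \<longleftrightarrow>
    (\<exists>L. cyclic_coordinates act U L \<and> map fst L = map (\<lambda>(q, r). laurent_of_poly q ^ r) qs)"
    (is "module_isomorphic ?M ?N \<longleftrightarrow> ?R")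
proof -
  let ?n = "length qs"
  define D where "D i = (case qs ! i of (q, r) \<Rightarrow> laurent_of_poly q ^ r)" for i
  define K where "K i = {b. D i dvd b}" for i
  interpret Modules.module act by (rule act)
  note M = quotient_laurent_module[OF act U]
  note C = quotient_laurent_module[OF module_mult, of "K i" for i, unfolded K_def,
      OF subspace_multiples_of, folded K_def]
  have cyclic: "(case qs ! i of (q, r) \<Rightarrow> cyclic_module q r) = quotient_module (laurent_module (*)) (K i)" for i
    by (simp add: cyclic_module_eq K_def D_def split: prod.split)
  have eq_coset: "coset_of (K i) x = coset_of (K i) y \<longleftrightarrow> D i dvd x - y" for i x y
    by (simp add: C(1)) (simp add: K_def)
  have carrier_N: "carrier ?N = (\<Pi>\<^sub>E i\<in>{..<?n}. range (coset_of (K i)))"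
    unfolding direct_sum_module_def Let_def by (auto intro!: PiE_cong simp: cyclic C(2))
  have add_N: "f \<oplus>\<^bsub>?N\<^esub> g = (\<lambda>i\<in>{..<?n}. f i \<oplus>\<^bsub>quotient_module (laurent_module (*)) (K i)\<^esub> g i)" for f g
    unfolding direct_sum_module_def Let_def by (auto simp: fun_eq_iff restrict_def cyclic)
  have smult_N: "r \<odot>\<^bsub>?N\<^esub> f = (\<lambda>i\<in>{..<?n}. r \<odot>\<^bsub>quotient_module (laurent_module (*)) (K i)\<^esub> f i)" for r f
    unfolding direct_sum_module_def Let_def by (auto simp: fun_eq_iff restrict_def cyclic)
  show ?thesis
  proof
    assume ?R
    then obtain L where L: "cyclic_coordinates act U L" and "map fst L = map (\<lambda>(q, r). laurent_of_poly q ^ r) qs"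
      by blast
    then have len: "length L = ?n" and "\<And>i. i < ?n \<Longrightarrow> fst (L ! i) = D i"
      by (metis length_map) (metis D_def length_map nth_map \<open>map fst L = _\<close>)
    define c where "c i = snd (L ! i)" for i
    have L_nth: "L ! i = (D i, c i)" if "i < ?n" for i
      using that \<open>\<And>i. i < ?n \<Longrightarrow> fst (L ! i) = D i\<close> by (simp add: c_def prod_eq_iff)
    have L_set: "(D i, c i) \<in> set L" if "i < ?n" for i
      using that L_nth len by (metis nth_mem)
    have c_add: "D i dvd c i (a + b) - (c i a + c i b)" and c_act: "D i dvd c i (act r a) - r * c i a"
      if "i < ?n" for i a b r
      using L L_set[OF that] unfolding cyclic_coordinates_def by blast+
    have U_iff: "u \<in> U \<longleftrightarrow> (\<forall>i<?n. D i dvd c i u)" for u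
    proof -
      have "u \<in> U \<longleftrightarrow> (\<forall>(d, c)\<in>set L. d dvd c u)"
        using L unfolding cyclic_coordinates_def by blast
      then show ?thesis by (simp add: all_set_conv_all_nth len L_nth)
    qed
    define H where "H x = (\<lambda>i\<in>{..<?n}. coset_of (K i) (c i x))" for x
    have H_eq: "H x = H y \<longleftrightarrow> (\<forall>i<?n. D i dvd c i x - c i y)" for x y
      by (auto simp: H_def fun_eq_iff restrict_def eq_coset)
    have same: "coset_of U x = coset_of U y \<longleftrightarrow> H x = H y" for x y
    proof -
      have "D i dvd c i x - c i y \<longleftrightarrow> D i dvd c i (x - y)" if "i < ?n" for i
        using c_add[OF that, of "x - y" y] dvd_add_right_iff[of "D i" "c i x - (c i (x - y) + c i y)" "c i (x - y)"]
        by (simp add: algebra_simps)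
      then show ?thesis by (simp add: M(1) U_iff H_eq)
    qed
    define h where "h X = H (inv_into UNIV (coset_of U) X)" for X
    have h: "h (coset_of U x) = H x" for x
      unfolding h_def by (rule bij_betw_ranges(2)[OF same])
    have "range H = carrier ?N"
    proof (intro equalityI subsetI)
      fix f
      assume f: "f \<in> carrier ?N"
      then have "\<forall>i<?n. \<exists>g. f i = coset_of (K i) g" unfolding carrier_N by (auto simp: PiE_def Pi_def)
      then obtain g where g: "\<And>i. i < ?n \<Longrightarrow> f i = coset_of (K i) (g i)" by metis
      have "length (map g [0..<?n]) = length L" by (simp add: len)
      then obtain a where "list_all2 (\<lambda>(d, c) g. d dvd c a - g) L (map g [0..<?n])"
        using L unfolding cyclic_coordinates_def by blast
      then have "D i dvd g i - c i a" if "i < ?n" for i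
        using that list_all2_nthD[of _ L _ i] dvd_diff_swap[of "D i" "c i a" "g i"]
        by (fastforce simp: len L_nth)
      then have "f i = H a i" for i
        using f g[of i] unfolding carrier_N H_def
        by (cases "i < ?n") (auto simp: eq_coset PiE_def extensional_def)
      then show "f \<in> range H" by auto
    qed (auto simp: carrier_N H_def)
    then have "bij_betw h (carrier ?M) (carrier ?N)"
      unfolding h_def M(2) using bij_betw_ranges(1)[of "coset_of U" H, OF same] by simp
    moreover have "h (X \<oplus>\<^bsub>?M\<^esub> Y) = h X \<oplus>\<^bsub>?N\<^esub> h Y" if "X \<in> carrier ?M" "Y \<in> carrier ?M" for X Y
      using that unfolding M(2)
      by (auto simp: M(3) h add_N) (auto simp: H_def restrict_def fun_eq_iff C(3) eq_coset c_add)
    moreover have "h (r \<odot>\<^bsub>?M\<^esub> X) = r \<odot>\<^bsub>?N\<^esub> h X" if "X \<in> carrier ?M" for r X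
      using that unfolding M(2)
      by (auto simp: M(4) h smult_N) (auto simp: H_def restrict_def fun_eq_iff C(4) eq_coset c_act)
    ultimately show "module_isomorphic ?M ?N" unfolding module_isomorphic_def by blast
  next
    assume "module_isomorphic ?M ?N"
    then obtain h where bij: "bij_betw h (carrier ?M) (carrier ?N)"
      and add: "\<And>X Y. X \<in> carrier ?M \<Longrightarrow> Y \<in> carrier ?M \<Longrightarrow> h (X \<oplus>\<^bsub>?M\<^esub> Y) = h X \<oplus>\<^bsub>?N\<^esub> h Y"
      and smult: "\<And>r X. X \<in> carrier ?M \<Longrightarrow> h (r \<odot>\<^bsub>?M\<^esub> X) = r \<odot>\<^bsub>?N\<^esub> h X"
      unfolding module_isomorphic_def by blast
    define H where "H x = h (coset_of U x)" for x
    have H_carrier: "H x \<in> carrier ?N" for x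
      using bij_betwE[OF bij] unfolding H_def M(2) by blast
    have "\<forall>i x. \<exists>c. i < ?n \<longrightarrow> H x i = coset_of (K i) c"
      using PiE_mem[OF H_carrier[unfolded carrier_N]] by fastforce
    then obtain c where c: "\<And>x i. i < ?n \<Longrightarrow> H x i = coset_of (K i) (c i x)" by metis
    have c_add: "D i dvd c i (a + b) - (c i a + c i b)" if "i < ?n" for i a b
    proof -
      have "H (a + b) = H a \<oplus>\<^bsub>?N\<^esub> H b"
        using add[of "coset_of U a" "coset_of U b"] by (simp add: H_def M(2,3))
      then have "H (a + b) i = coset_of (K i) (c i a + c i b)" using that by (simp add: add_N c C(3))
      then show ?thesis using that by (simp add: c eq_coset)
    qed
    have c_act: "D i dvd c i (act r a) - r * c i a" if "i < ?n" for i a r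
    proof -
      have "H (act r a) = r \<odot>\<^bsub>?N\<^esub> H a"
        using smult[of "coset_of U a" r] by (simp add: H_def M(2,4))
      then have "H (act r a) i = coset_of (K i) (r * c i a)" using that by (simp add: smult_N c C(4))
      then show ?thesis using that by (simp add: c eq_coset)
    qed
    have U_iff: "u \<in> U \<longleftrightarrow> (\<forall>i<?n. D i dvd c i u)" for u
    proof -
      have "u \<in> U \<longleftrightarrow> coset_of U u = coset_of U 0" by (simp add: M(1))
      also have "\<dots> \<longleftrightarrow> H u = H 0"
        unfolding H_def using bij_betw_imp_inj_on[OF bij, unfolded M(2)] by (auto dest: inj_onD)
      also have "\<dots> \<longleftrightarrow> (\<forall>i<?n. H u i = H 0 i)"
        using PiE_ext[OF H_carrier[of u, unfolded carrier_N] H_carrier[of 0, unfolded carrier_N]] by auto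
      also have "\<dots> \<longleftrightarrow> (\<forall>i<?n. D i dvd c i u - c i 0)" by (simp add: c eq_coset)
      \<comment> \<open>The representative \<open>c i 0\<close> may be nonzero, but additivity
        modulo \<open>D i\<close> at 0 + 0 makes it a multiple of \<open>D i\<close>.\<close>
      also have "\<dots> \<longleftrightarrow> (\<forall>i<?n. D i dvd c i u)"
      proof -
        have "D i dvd c i u - c i 0 \<longleftrightarrow> D i dvd c i u" if "i < ?n" for i
          using c_add[OF that, of 0 0] dvd_add_left_iff[of "D i" "- c i 0" "c i u"] by simp
        then show ?thesis by simp
      qed
      finally show ?thesis .
    qed
    define L where "L = map (\<lambda>i. (D i, c i)) [0..<?n]"
    have "cyclic_coordinates act U L"
      unfolding cyclic_coordinates_def
    proof (intro conjI allI impI)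
      fix gs :: "'p laurent list"
      assume "length gs = length L"
      let ?f = "\<lambda>i\<in>{..<?n}. coset_of (K i) (gs ! i)"
      have "?f \<in> carrier ?N" by (auto simp: carrier_N)
      then have "?f \<in> h ` carrier ?M" using bij by (simp add: bij_betw_def)
      then obtain a where a: "?f = H a" unfolding M(2) H_def by blast
      have "coset_of (K i) (c i a) = coset_of (K i) (gs ! i)" if "i < ?n" for i
        using that c[OF that, of a] fun_cong[OF a, of i] by simp
      then show "\<exists>a. list_all2 (\<lambda>(d, c) g. d dvd c a - g) L gs"
        using \<open>length gs = length L\<close>
        by (intro exI[of _ a]) (simp add: L_def list_all2_conv_all_nth eq_coset)
    qed (auto simp: L_def c_add c_act U_iff)
    moreover have "map fst L = map (\<lambda>(q, r). laurent_of_poly q ^ r) qs"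
      by (rule nth_equalityI) (simp_all add: L_def D_def split: prod.split)
    ultimately show ?R by blast
  qed
qed

text \<open>The Chinese remainder theorem: for comaximal d1 and d2 the summand R/d1d2 splits, and
  the same coordinate function serves both parts.\<close>

lemma cyclic_coordinates_split:
  fixes L1 :: "('r::comm_ring_1 \<times> ('m::ab_group_add \<Rightarrow> 'r)) list"
  assumes L: "cyclic_coordinates act U (L1 @ (d1 * d2, c) # L2)" and bezout: "x * d1 + y * d2 = 1"
  shows "cyclic_coordinates act U (L1 @ (d1, c) # (d2, c) # L2)"
proof -
  have dvd_iff: "d1 * d2 dvd a \<longleftrightarrow> d1 dvd a \<and> d2 dvd a" for a
  proof
    assume a: "d1 dvd a \<and> d2 dvd a"
    have "d1 * d2 dvd x * (d1 * a) + y * (a * d2)"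
      using a by (intro dvd_add dvd_mult mult_dvd_mono) auto
    also have "\<dots> = (x * d1 + y * d2) * a" by (simp add: algebra_simps)
    finally show "d1 * d2 dvd a" by (simp add: bezout)
  qed (auto intro: dvd_mult_left dvd_mult_right)
  show ?thesis
    unfolding cyclic_coordinates_def
  proof (intro conjI allI impI)
    fix gs :: "'r list"
    assume len: "length gs = length (L1 @ (d1, c) # (d2, c) # L2)"
    define gs1 ys where "gs1 = take (length L1) gs" and "ys = drop (length L1) gs"
    with len have "length gs1 = length L1" "length ys = Suc (Suc (length L2))" "gs = gs1 @ ys"
      by simp_all
    then obtain g1 g2 gs2 where gs: "gs = gs1 @ g1 # g2 # gs2" "length gs1 = length L1" "length gs2 = length L2"
      by (auto simp: length_Suc_conv)
    \<comment> \<open>Since y d2 is 1 modulo d1 and x d1 is 1 modulo d2, this element is congruent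
      to g1 modulo d1 and to g2 modulo d2.\<close>
    let ?g = "g1 * y * d2 + g2 * x * d1"
    have "length (gs1 @ ?g # gs2) = length (L1 @ (d1 * d2, c) # L2)" by (simp add: gs)
    with L obtain a where "list_all2 (\<lambda>(d, c) g. d dvd c a - g) (L1 @ (d1 * d2, c) # L2) (gs1 @ ?g # gs2)"
      unfolding cyclic_coordinates_def by blast
    then have a: "list_all2 (\<lambda>(d, c) g. d dvd c a - g) L1 gs1" "d1 * d2 dvd c a - ?g"
      "list_all2 (\<lambda>(d, c) g. d dvd c a - g) L2 gs2"
      using gs by (simp_all add: list_all2_append)
    have eq1: "c a - g1 = (c a - ?g) + d1 * (x * (g2 - g1)) + g1 * (x * d1 + y * d2 - 1)"
      by (simp add: algebra_simps)
    have "d1 dvd c a - g1"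
      using a(2) unfolding eq1 bezout dvd_iff diff_self mult_zero_right add_0_right
      by (intro dvd_add) simp_all
    moreover have eq2: "c a - g2 = (c a - ?g) + d2 * (y * (g1 - g2)) + g2 * (x * d1 + y * d2 - 1)"
      by (simp add: algebra_simps)
    have "d2 dvd c a - g2"
      using a(2) unfolding eq2 bezout dvd_iff diff_self mult_zero_right add_0_right
      by (intro dvd_add) simp_all
    ultimately show "\<exists>a. list_all2 (\<lambda>(d, c) g. d dvd c a - g) (L1 @ (d1, c) # (d2, c) # L2) gs"
      using a gs by (intro exI[of _ a]) (simp add: list_all2_append)
  qed (use L in \<open>auto simp: cyclic_coordinates_def dvd_iff\<close>)
qed

text \<open>For a unit d the summand R/d is zero. Prescribed values lift after inserting an
  arbitrary entry, here 0, in its place.\<close>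

lemma cyclic_coordinates_drop_unit:
  fixes L1 :: "('r::comm_ring_1 \<times> ('m::ab_group_add \<Rightarrow> 'r)) list"
  assumes L: "cyclic_coordinates act U (L1 @ (d, c) # L2)" and "d dvd 1"
  shows "cyclic_coordinates act U (L1 @ L2)"
  unfolding cyclic_coordinates_def
proof (intro conjI allI impI)
  fix gs :: "'r list"
  assume "length gs = length (L1 @ L2)"
  then have "length (take (length L1) gs @ 0 # drop (length L1) gs) = length (L1 @ (d, c) # L2)"
    by simp
  with L obtain a where "list_all2 (\<lambda>(d, c) g. d dvd c a - g) (L1 @ (d, c) # L2)
      (take (length L1) gs @ 0 # drop (length L1) gs)"
    unfolding cyclic_coordinates_def by blast
  then have "list_all2 (\<lambda>(d, c) g. d dvd c a - g) L1 (take (length L1) gs)"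
    "list_all2 (\<lambda>(d, c) g. d dvd c a - g) L2 (drop (length L1) gs)"
    using \<open>length gs = _\<close> by (simp_all add: list_all2_append)
  from list_all2_appendI[OF this] show "\<exists>a. list_all2 (\<lambda>(d, c) g. d dvd c a - g) (L1 @ L2) gs" by auto
qed (use L dvd_trans[OF assms(2) one_dvd] in \<open>auto simp: cyclic_coordinates_def\<close>)

definition primary_modulus :: "('p::prime_card) laurent \<Rightarrow> bool" where
  "primary_modulus d \<longleftrightarrow> (\<exists>q r. 1 \<le> r \<and> (q = 0 \<or> irreducible q \<and> poly q 0 = 1) \<and> d = laurent_of_poly q ^ r)"

text \<open>A factor of f has nonzero constant term because f does, so it can be scaled to value 1
  at 0.\<close>

lemma exists_normalized_irreducible_factor:
  fixes f :: "('p::prime_card) mod_ring poly"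
  assumes "degree f > 0" and "poly f 0 \<noteq> 0"
  obtains q where "irreducible q" "poly q 0 = 1" "q dvd f"
proof -
  have "f \<noteq> 0" "\<not> is_unit f" using assms by (auto simp: is_unit_iff_degree)
  then obtain q where q: "prime_elem q" "q dvd f" by (metis prime_divisor_exists prime_def)
  then have nz: "poly q 0 \<noteq> 0" using assms(2) by (auto elim!: dvdE)
  let ?q = "Polynomial.smult (inverse (poly q 0)) q"
  have "irreducible ?q"
    using prime_elem_imp_irreducible[OF q(1)] nz irreducible_mult_unit_left[of "[:inverse (poly q 0):]" q]
    by simp
  moreover have "?q dvd f" using q(2) nz by (simp add: smult_dvd_iff)
  ultimately show ?thesis using nz by (intro that[of ?q]) simp_all
qed

text \<open>Induction on the degree of f. A nonzero constant gives a unit and is dropped, a factor x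
  is absorbed by \<open>xpow k\<close>, and otherwise the full power of a normalized irreducible
  factor is split off. Taking the full power makes it coprime to the cofactor.\<close>

lemma cyclic_coordinates_refine_one:
  fixes f :: "('p::prime_card) mod_ring poly"
  assumes "f \<noteq> 0" and "cyclic_coordinates act U (L1 @ (xpow k * laurent_of_poly f, c) # L2)"
  shows "\<exists>L. (\<forall>(d, c)\<in>set L. primary_modulus d) \<and> cyclic_coordinates act U (L1 @ L @ L2)"
  using assms
proof (induction "degree f" arbitrary: f k L1 rule: less_induct)
  case less
  show ?case
  proof (cases "degree f = 0")
    case True
    then obtain b where b: "f = [:b:]" by (metis degree_0_id)
    with less.prems have "b \<noteq> 0" by simp
    have "xpow k * laurent_of_poly f * (xpow (- k) * laurent_of_poly [:inverse b:])
      = (xpow k * xpow (- k)) * (laurent_of_poly f * laurent_of_poly [:inverse b:])"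
      by (simp only: mult_ac)
    also have "\<dots> = laurent_of_poly (f * [:inverse b:])"
      by (simp only: xpow_mult add.right_inverse xpow_0 mult_1_left laurent_of_poly_mult)
    also have "f * [:inverse b:] = 1" using \<open>b \<noteq> 0\<close> by (simp add: b one_pCons)
    finally have "xpow k * laurent_of_poly f dvd 1" by (metis dvdI laurent_of_poly_1)
    from cyclic_coordinates_drop_unit[OF less.prems(2) this] show ?thesis
      by (intro exI[of _ "[]"]) simp
  next
    case False
    show ?thesis
    proof (cases "poly f 0 = 0")
      case True
      then obtain g where g: "f = pCons 0 g" by (metis poly_pCons pCons_cases mult_zero_left add.right_neutral)
      have "xpow k * laurent_of_poly f = xpow (k + 1) * laurent_of_poly g"
        by (simp add: g laurent_of_poly_pCons_0 xpow_mult flip: mult.assoc)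
      then show ?thesis using less.hyps[of g L1 "k + 1"] less.prems g by auto
    next
      case nz: False
      obtain q where q: "irreducible q" "poly q 0 = 1" "q dvd f"
        using exists_normalized_irreducible_factor[of f] False nz by auto
      then have prime: "prime_elem q" by (simp add: irreducible_imp_prime_elem)
      have "\<not> is_unit q" using q(1) by (rule irreducible_not_unit)
      then obtain g where g: "f = q ^ multiplicity q f * g" "\<not> q dvd g"
        using multiplicity_decompose'[OF less.prems(1)] by metis
      let ?r = "multiplicity q f"
      have r: "1 \<le> ?r" using q(3) less.prems(1) \<open>\<not> is_unit q\<close>
        by (simp add: multiplicity_gt_zero_iff Suc_le_eq)
      have "g \<noteq> 0" "q \<noteq> 0" using g(2) q(2) by auto
      moreover have "degree q > 0" using \<open>\<not> is_unit q\<close> \<open>q \<noteq> 0\<close> by (simp add: is_unit_iff_degree)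
      ultimately have deg: "degree g < degree f"
        using r by (subst g(1)) (simp add: degree_mult_eq degree_power_eq)
      have "coprime (q ^ ?r) g" using prime g(2) by (simp add: prime_elem_imp_coprime)
      then obtain s t where st: "s * q ^ ?r + t * g = 1"
        by (metis bezout_coefficients_fst_snd coprime_iff_gcd_eq_1)
      have bezout: "laurent_of_poly s * laurent_of_poly q ^ ?r
          + (laurent_of_poly t * xpow (- k)) * (xpow k * laurent_of_poly g) = 1"
        using arg_cong[OF st, of laurent_of_poly]
        by (simp add: laurent_of_poly_add laurent_of_poly_mult laurent_of_poly_power mult.assoc)
      have f: "xpow k * laurent_of_poly f = laurent_of_poly q ^ ?r * (xpow k * laurent_of_poly g)"
        by (subst g(1)) (simp add: laurent_of_poly_mult laurent_of_poly_power mult.left_commute)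
      have "cyclic_coordinates act U ((L1 @ [(laurent_of_poly q ^ ?r, c)])
          @ (xpow k * laurent_of_poly g, c) # L2)"
        using cyclic_coordinates_split[OF less.prems(2)[unfolded f] bezout] by simp
      from less.hyps[OF deg \<open>g \<noteq> 0\<close> this] obtain L where
        "\<forall>(d, c)\<in>set L. primary_modulus d"
        "cyclic_coordinates act U (L1 @ ((laurent_of_poly q ^ ?r, c) # L) @ L2)" by auto
      moreover have "primary_modulus (laurent_of_poly q ^ ?r)"
        unfolding primary_modulus_def using q r by blast
      ultimately show ?thesis by (intro exI[of _ "(laurent_of_poly q ^ ?r, c) # L"]) simp
    qed
  qed
qed

lemma cyclic_coordinates_refine:
  fixes L1 :: "(('p::prime_card) laurent \<times> _) list"
  assumes "cyclic_coordinates act U (L1 @ L2)" and "\<forall>(d, c)\<in>set L1. primary_modulus d"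
  shows "\<exists>L. (\<forall>(d, c)\<in>set L. primary_modulus d) \<and> cyclic_coordinates act U L"
  using assms
proof (induction L2 arbitrary: L1)
  case (Cons y L2)
  obtain d c where y: "y = (d, c)" by (cases y)
  have "\<exists>L. (\<forall>(d, c)\<in>set L. primary_modulus d) \<and> cyclic_coordinates act U (L1 @ L @ L2)"
  proof (cases "d = 0")
    case True
    then have "primary_modulus d"
      unfolding primary_modulus_def by (intro exI[of _ 0] exI[of _ 1]) simp
    then show ?thesis using Cons.prems(1) y by (intro exI[of _ "[y]"]) simp
  next
    case False
    obtain k f where d: "d = xpow k * laurent_of_poly f" by (rule laurent_eq_xpow_mult_poly)
    with False have "f \<noteq> 0" by auto
    then show ?thesis using Cons.prems(1) unfolding y d by (rule cyclic_coordinates_refine_one)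
  qed
  then obtain L where "\<forall>(d, c)\<in>set L. primary_modulus d" "cyclic_coordinates act U (L1 @ L @ L2)"
    by blast
  then have "\<forall>(d, c)\<in>set (L1 @ L). primary_modulus d" "cyclic_coordinates act U ((L1 @ L) @ L2)"
    using Cons.prems(2) by auto
  then show ?case by (intro Cons.IH)
qed auto

text \<open>\<open>\<Phi>\<close> identifies the module with R^N, where the given action becomes
  multiplication. Diagonal coordinates are found there and then refined to primary ones.\<close>

lemma exists_primary_coordinates:
  fixes act :: "('p::prime_card) laurent \<Rightarrow> 'm \<Rightarrow> 'm::ab_group_add" and \<Phi> :: "'m \<Rightarrow> nat \<Rightarrow> 'p laurent"
  assumes U: "0 \<in> U" "\<And>a b r. a \<in> U \<Longrightarrow> b \<in> U \<Longrightarrow> a + act r b \<in> U"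
    and linear: "\<And>a b i. \<Phi> (a + b) i = \<Phi> a i + \<Phi> b i" "\<And>r a i. \<Phi> (act r a) i = r * \<Phi> a i"
    and support: "\<And>a i. i \<ge> N \<Longrightarrow> \<Phi> a i = 0"
    and inj: "inj \<Phi>" and surj: "\<And>f. (\<And>i. i \<ge> N \<Longrightarrow> f i = 0) \<Longrightarrow> \<exists>a. \<Phi> a = f"
  shows "\<exists>L. (\<forall>(d, c)\<in>set L. primary_modulus d) \<and> cyclic_coordinates act U L"
proof -
  have "function_submodule (\<Phi> ` U)"
    unfolding function_submodule_def
  proof (intro conjI ballI allI)
    fix f g c
    assume "f \<in> \<Phi> ` U" "g \<in> \<Phi> ` U"
    then obtain a b where "f = \<Phi> a" "g = \<Phi> b" "a \<in> U" "b \<in> U" by blast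
    then have "(\<lambda>i. f i + c * g i) = \<Phi> (a + act c b)" "a + act c b \<in> U"
      using U(2) by (simp_all add: fun_eq_iff linear)
    then show "(\<lambda>i. f i + c * g i) \<in> \<Phi> ` U" by blast
  qed (use U(1) in blast)
  from submodule_coordinates[of laurent_size, OF laurent_division this, of N] support
  obtain \<phi> d where \<phi>: "coordinate_change N \<phi>"
    and d: "\<And>u. \<forall>i\<ge>N. u i = 0 \<Longrightarrow> u \<in> \<Phi> ` U \<longleftrightarrow> (\<forall>i<N. d i dvd \<phi> u i)" by blast
  have \<phi>_linear: "\<phi> (\<lambda>i. f i + c * g i) = (\<lambda>i. \<phi> f i + c * \<phi> g i)" for f g c
    using \<phi> by (simp add: coordinate_change_def)
  define L where "L = map (\<lambda>i. (d i, \<lambda>a. \<phi> (\<Phi> a) i)) [0..<N]"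
  have "cyclic_coordinates act U L"
    unfolding cyclic_coordinates_def
  proof (intro conjI allI impI)
    fix gs :: "'p laurent list"
    assume "length gs = length L"
    define f where "f = inv_into UNIV \<phi> (\<lambda>i. if i < N then gs ! i else 0)"
    have f: "\<phi> f = (\<lambda>i. if i < N then gs ! i else 0)"
      unfolding f_def using \<phi> by (simp add: coordinate_change_def bij_is_surj surj_f_inv_f)
    have "f i = 0" if "i \<ge> N" for i
      using \<phi> that fun_cong[OF f, of i] by (simp add: coordinate_change_def)
    then obtain a where "\<Phi> a = f" using surj by blast
    then show "\<exists>a. list_all2 (\<lambda>(d, c) g. d dvd c a - g) L gs"
      using \<open>length gs = length L\<close> f
      by (intro exI[of _ a]) (simp add: L_def list_all2_conv_all_nth)
  next
    fix u
    have "u \<in> U \<longleftrightarrow> \<Phi> u \<in> \<Phi> ` U" using inj by (auto dest: injD)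
    then show "u \<in> U \<longleftrightarrow> (\<forall>(d, c)\<in>set L. d dvd c u)" using d[of "\<Phi> u"] support by (auto simp: L_def)
  next
    have "\<Phi> (a + b) = (\<lambda>i. \<Phi> a i + 1 * \<Phi> b i)" for a b by (simp add: fun_eq_iff linear)
    then have "\<phi> (\<Phi> (a + b)) = (\<lambda>i. \<phi> (\<Phi> a) i + 1 * \<phi> (\<Phi> b) i)" for a b
      by (simp only: \<phi>_linear)
    moreover have "\<phi> (\<lambda>i. 0) = (\<lambda>i. 0)"
      using \<phi>_linear[of "\<lambda>i. 0" "- 1" "\<lambda>i. 0"] by (simp add: fun_eq_iff)
    moreover have "\<Phi> (act r a) = (\<lambda>i. 0 + r * \<Phi> a i)" for r a by (simp add: fun_eq_iff linear)
    then have "\<phi> (\<Phi> (act r a)) = (\<lambda>i. \<phi> (\<lambda>i. 0) i + r * \<phi> (\<Phi> a) i)" for r a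
      by (simp only: \<phi>_linear)
    ultimately show "\<forall>(d, c)\<in>set L. (\<forall>a b. d dvd c (a + b) - (c a + c b)) \<and> (\<forall>r a. d dvd c (act r a) - r * c a)"
      by (simp add: L_def)
  qed
  then show ?thesis using cyclic_coordinates_refine[of act U "[]" L] by simp
qed

section \<open>The module structure of period \<open>e\<close>\<close>

definition lamp_action :: "nat \<Rightarrow> ('p::prime_card) laurent \<Rightarrow> ('p, 'n::finite) lamp \<Rightarrow> ('p, 'n) lamp" where
  "lamp_action e r a = push_exponents (\<lambda>k. int e * k) r *s a"

lemma lamp_module_eq: "lamp_module e = laurent_module (lamp_action e)"
  by (simp add: lamp_module_def lamp_action_def[abs_def])

lemma lamp_action_single: "lamp_action e (Poly_Mapping.single k c) a = Poly_Mapping.single (int e * k) c *s a"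
  by (simp add: lamp_action_def)

lemma module_lamp_action:
  "Modules.module (lamp_action e :: ('p::prime_card) laurent \<Rightarrow> ('p, 'n::finite) lamp \<Rightarrow> _)"
proof
  fix r s :: "'p laurent" and a b :: "('p, 'n) lamp"
  show "lamp_action e r (a + b) = lamp_action e r a + lamp_action e r b"
    by (simp add: lamp_action_def vector_add_ldistrib)
  show "lamp_action e (r + s) a = lamp_action e r a + lamp_action e s a"
    by (simp add: lamp_action_def push_exponents_add vector_sadd_rdistrib)
  show "lamp_action e r (lamp_action e s a) = lamp_action e (r * s) a"
    by (simp add: lamp_action_def push_exponents_mult distrib_left vector_smult_assoc)
  show "lamp_action e 1 a = a"
    by (simp add: lamp_action_def vector_smult_lid)
qed

text \<open>For j < e this is the coefficient of x^j when R is viewed as a free module over the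
  Laurent polynomials in x^e with basis 1, x, ..., x^(e-1).\<close>

definition exponent_section :: "nat \<Rightarrow> nat \<Rightarrow> ('p::prime_card) laurent \<Rightarrow> 'p laurent" where
  "exponent_section e j = Poly_Mapping.map_key (\<lambda>k. int e * k + int j)"

lemma lookup_exponent_section:
  "0 < e \<Longrightarrow> Poly_Mapping.lookup (exponent_section e j a) k = Poly_Mapping.lookup a (int e * k + int j)"
  unfolding exponent_section_def by (subst map_key.rep_eq) (auto simp: inj_on_def)

lemma exponent_section_add:
  "0 < e \<Longrightarrow> exponent_section e j (a + b) = exponent_section e j a + exponent_section e j b"
  by (rule poly_mapping_eqI) (simp add: lookup_exponent_section lookup_add)

lemma exponent_section_sum:
  "0 < e \<Longrightarrow> exponent_section e j (\<Sum>i\<in>I. f i) = (\<Sum>i\<in>I. exponent_section e j (f i))"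
  by (rule poly_mapping_eqI) (simp add: lookup_exponent_section lookup_sum)

lemma exponent_section_push_mult:
  assumes "0 < e"
  shows "exponent_section e j (push_exponents (\<lambda>k. int e * k) r * a) = r * exponent_section e j a"
proof (induction r rule: laurent_induct)
  case (single i c)
  have shift: "int e * k + int j - int e * i = int e * (k - i) + int j" for k
    by (simp add: algebra_simps)
  show ?case
    by (rule poly_mapping_eqI)
      (simp only: lookup_exponent_section[OF assms] push_exponents_single lookup_single_mult shift)
qed (simp add: push_exponents_add distrib_right exponent_section_add assms)

lemma exponent_section_xpow:
  assumes "i < e" and "j < e"
  shows "exponent_section e i (xpow (int j)) = (if i = j then 1 else (0 :: ('p::prime_card) laurent))"
proof (rule poly_mapping_eqI)
  fix k
  have "int j = int e * k + int i \<longleftrightarrow> i = j \<and> k = 0"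
  proof
    assume eq: "int j = int e * k + int i"
    have "int j mod int e = int i mod int e" unfolding eq by simp
    with assms have "i = j" by (simp flip: of_nat_mod)
    with eq assms show "i = j \<and> k = 0" by auto
  qed simp
  with assms show "Poly_Mapping.lookup (exponent_section e i (xpow (int j) :: 'p laurent)) k
    = Poly_Mapping.lookup (if i = j then 1 else 0) k"
    by (simp add: lookup_exponent_section lookup_single lookup_one when_def)
qed

lemma exponent_sections_eqI:
  assumes "0 < e" and "\<And>j. j < e \<Longrightarrow> exponent_section e j a = exponent_section e j b"
  shows "a = b"
proof (rule poly_mapping_eqI)
  fix k
  have "Poly_Mapping.lookup c k
      = Poly_Mapping.lookup (exponent_section e (nat (k mod int e)) c) (k div int e)" for c :: "'a laurent"
    using assms(1) by (simp add: lookup_exponent_section)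
  moreover have "nat (k mod int e) < e" using assms(1) by (simp add: nat_less_iff)
  ultimately show "Poly_Mapping.lookup a k = Poly_Mapping.lookup b k" using assms(2) by simp
qed

text \<open>The element with sections f_j is the sum of f_j(x^e) x^j over j < e.\<close>

lemma exponent_sections_surj:
  fixes f :: "nat \<Rightarrow> ('p::prime_card) laurent"
  obtains a where "\<And>i. i < e \<Longrightarrow> exponent_section e i a = f i"
proof
  fix i
  assume i: "i < e"
  have "exponent_section e i (\<Sum>j<e. push_exponents (\<lambda>k. int e * k) (f j) * xpow (int j))
    = (\<Sum>j<e. f j * (if i = j then 1 else 0))"
    using i by (subst exponent_section_sum)
      (auto intro!: sum.cong simp: exponent_section_push_mult exponent_section_xpow)
  also have "\<dots> = f i" using i by (simp add: if_distrib[of "(*) _"] cong: if_cong)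
  finally show "exponent_section e i (\<Sum>j<e. push_exponents (\<lambda>k. int e * k) (f j) * xpow (int j)) = f i" .
qed

lemma lamp_primary_coordinates:
  fixes U :: "('p::prime_card, 'n::finite) lamp set"
  assumes e: "0 < e" and U: "Modules.module.subspace (lamp_action e) U"
  shows "\<exists>L. (\<forall>(d, c)\<in>set L. primary_modulus d) \<and> cyclic_coordinates (lamp_action e) U L"
proof -
  interpret Modules.module "lamp_action e :: _ \<Rightarrow> ('p, 'n) lamp \<Rightarrow> _" by (rule module_lamp_action)
  obtain g where g: "bij_betw g {0..<CARD('n)} (UNIV :: 'n set)"
    using ex_bij_betw_nat_finite[of "UNIV :: 'n set"] by auto
  define g' where "g' = inv_into {0..<CARD('n)} g"
  have g': "g' i < CARD('n)" "g (g' i) = i" for i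
    using g bij_betw_inv_into_right[OF g, of i] bij_betwE[OF bij_betw_inv_into[OF g]]
    by (auto simp: g'_def)
  have g'_g: "g' (g l) = l" if "l < CARD('n)" for l
    using bij_betw_inv_into_left[OF g, of l] that by (simp add: g'_def)
  \<comment> \<open>The index l encodes a component, through its quotient by e, and an exponent
    class modulo e, through its remainder. This exhibits the rank n e.\<close>
  define \<Phi> where "\<Phi> v l = (if l < CARD('n) * e then exponent_section e (l mod e) (v $ g (l div e)) else 0)"
    for v :: "('p, 'n) lamp" and l
  have div_less: "l div e < CARD('n)" if "l < CARD('n) * e" for l
    using that e by (simp add: div_less_iff_less_mult)
  have index_less: "g' i * e + j < CARD('n) * e" if "j < e" for i j
  proof -
    have "g' i * e + j < Suc (g' i) * e" using that by simp
    also have "\<dots> \<le> CARD('n) * e" using g'(1)[of i] by (intro mult_right_mono) auto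
    finally show ?thesis .
  qed
  show ?thesis
  proof (rule exists_primary_coordinates[where \<Phi> = \<Phi> and N = "CARD('n) * e"])
    show "0 \<in> U" using U by (rule subspace_0)
    show "a + lamp_action e r b \<in> U" if "a \<in> U" "b \<in> U" for a b r
      using U that by (intro subspace_add subspace_scale)
    show "\<Phi> (a + b) i = \<Phi> a i + \<Phi> b i" "\<Phi> (lamp_action e r a) i = r * \<Phi> a i" for a b i r
      using e by (simp_all add: \<Phi>_def exponent_section_add lamp_action_def exponent_section_push_mult)
    show "inj \<Phi>"
    proof
      fix v w
      assume eq: "\<Phi> v = \<Phi> w"
      have "v $ i = w $ i" for i
      proof (rule exponent_sections_eqI[OF e])
        fix j
        assume "j < e"
        then show "exponent_section e j (v $ i) = exponent_section e j (w $ i)"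
          using fun_cong[OF eq, of "g' i * e + j"] index_less[of j i] by (simp add: \<Phi>_def g')
      qed
      then show "v = w" by (simp add: vec_eq_iff)
    qed
    show "\<exists>v. \<Phi> v = f" if f: "\<And>i. i \<ge> CARD('n) * e \<Longrightarrow> f i = 0" for f
    proof -
      have "\<exists>a. \<forall>j<e. exponent_section e j a = f (g' i * e + j)" for i
        by (metis exponent_sections_surj[of e "\<lambda>j. f (g' i * e + j)"])
      then obtain v where v: "\<And>i j. j < e \<Longrightarrow> exponent_section e j (v i) = f (g' i * e + j)" by metis
      have "\<Phi> (vec_lambda v) l = f l" for l
        using e v[of "l mod e" "g (l div e)"] g'_g[OF div_less[of l]] f[of l] by (simp add: \<Phi>_def)
      then show ?thesis by blast
    qed
  qed (simp add: \<Phi>_def)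
qed

section \<open>Shift-invariant subgroups and their periods\<close>

definition shift_invariant :: "int \<Rightarrow> ('p::prime_card, 'n::finite) lamp set \<Rightarrow> bool" where
  "shift_invariant k U \<longleftrightarrow> (\<lambda>u. xpow k *s u) ` U = U"

lemma shift_invariant_iff:
  "shift_invariant k U \<longleftrightarrow> (\<forall>u\<in>U. xpow k *s u \<in> U \<and> xpow (- k) *s u \<in> U)"
proof
  assume "shift_invariant k U"
  then have eq: "(\<lambda>u. xpow k *s u) ` U = U" by (simp add: shift_invariant_def)
  show "\<forall>u\<in>U. xpow k *s u \<in> U \<and> xpow (- k) *s u \<in> U"
  proof
    fix u
    assume "u \<in> U"
    then have "xpow k *s u \<in> U" using eq by blast
    moreover from \<open>u \<in> U\<close> eq obtain w where w: "w \<in> U" "u = xpow k *s w" by blast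
    have "xpow (- k) *s u = w" unfolding w(2) by (simp add: vector_smult_assoc xpow_mult vector_smult_lid)
    ultimately show "xpow k *s u \<in> U \<and> xpow (- k) *s u \<in> U" using w(1) by simp
  qed
next
  assume *: "\<forall>u\<in>U. xpow k *s u \<in> U \<and> xpow (- k) *s u \<in> U"
  have "u = xpow k *s (xpow (- k) *s u)" for u :: "('a, 'b) lamp"
    by (simp add: vector_smult_assoc xpow_mult vector_smult_lid)
  with * show "shift_invariant k U" unfolding shift_invariant_def by blast
qed

lemma shift_invariant_add:
  assumes "shift_invariant j U" and "shift_invariant k U"
  shows "shift_invariant (j + k) U"
proof -
  have "xpow (j + k) *s u = xpow j *s (xpow k *s u)" "xpow (- (j + k)) *s u = xpow (- j) *s (xpow (- k) *s u)"
    for u :: "('a, 'b) lamp" by (simp_all add: vector_smult_assoc xpow_mult)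
  with assms show ?thesis unfolding shift_invariant_iff by metis
qed

lemma shift_invariant_uminus: "shift_invariant k U \<Longrightarrow> shift_invariant (- k) U"
  by (simp add: shift_invariant_iff)

lemma shift_invariant_mult: "shift_invariant k U \<Longrightarrow> shift_invariant (k * l) U"
proof (induction l rule: int_induct[where k = 0])
  case base
  then show ?case by (simp add: shift_invariant_iff vector_smult_lid)
next
  case (step1 i)
  then show ?case using shift_invariant_add[of "k * i" U k] by (simp add: algebra_simps)
next
  case (step2 i)
  then show ?case using shift_invariant_add[of "k * i" U "- k"] shift_invariant_uminus[of k U]
    by (simp add: algebra_simps)
qed

lemma period_finite_iff: "period U \<noteq> \<infinity> \<longleftrightarrow> (\<exists>e>0. shift_invariant (int e) U)"
proof
  assume "period U \<noteq> \<infinity>"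
  then have "{enat e |e. 0 < e \<and> (\<lambda>u. xpow (int e) *s u) ` U = U} \<noteq> {}"
    unfolding period_def Inf_enat_def by presburger
  then show "\<exists>e>0. shift_invariant (int e) U" by (auto simp: shift_invariant_def)
next
  assume "\<exists>e>0. shift_invariant (int e) U"
  then obtain e where "period U \<le> enat e"
    unfolding period_def shift_invariant_def by (metis (mono_tags, lifting) Inf_lower mem_Collect_eq)
  then show "period U \<noteq> \<infinity>" by (cases "period U") auto
qed

text \<open>The integers k with x^k U = U form a subgroup of Z, so the least positive one generates
  it: the remainder of k modulo the period again fixes U and must be 0.\<close>

lemma period_minimal:
  assumes "period U \<noteq> \<infinity>"
  shows "0 < the_enat (period U)" and "shift_invariant (int (the_enat (period U))) U"
    and "shift_invariant k U \<Longrightarrow> int (the_enat (period U)) dvd k"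
proof -
  let ?A = "{enat e |e. 0 < e \<and> (\<lambda>u. xpow (int e) *s u) ` U = U}"
  have A: "enat e \<in> ?A \<longleftrightarrow> 0 < e \<and> shift_invariant (int e) U" for e
    by (simp add: shift_invariant_def)
  have "?A \<noteq> {}" using assms unfolding period_def Inf_enat_def by presburger
  then have "period U \<in> ?A" unfolding period_def Inf_enat_def by (auto intro: LeastI)
  moreover have period: "period U = enat (the_enat (period U))" using assms by auto
  ultimately have "enat (the_enat (period U)) \<in> ?A" by metis
  then show pos: "0 < the_enat (period U)" and inv: "shift_invariant (int (the_enat (period U))) U"
    unfolding A by auto
  assume k: "shift_invariant k U"
  let ?e = "the_enat (period U)"
  let ?r = "nat (k mod int ?e)"
  have "shift_invariant (k + - (int ?e * (k div int ?e))) U"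
    using k inv by (intro shift_invariant_add shift_invariant_uminus shift_invariant_mult)
  then have "shift_invariant (int ?r) U" using pos by (simp add: minus_mult_div_eq_mod)
  then have "enat ?r \<in> ?A" if "0 < ?r" using that unfolding A by blast
  then have "period U \<le> enat ?r" if "0 < ?r" using that unfolding period_def by (intro Inf_lower) auto
  then have "?e \<le> ?r" if "0 < ?r" using that unfolding enat_ord_simps(1)[symmetric] period[symmetric] .
  moreover have "?r < ?e" using pos by (simp add: nat_less_iff)
  ultimately have "?r = 0" by linarith
  then have "k mod int ?e \<le> 0" by simp
  moreover have "0 \<le> k mod int ?e" using pos by simp
  ultimately show "int ?e dvd k" by (intro dvd_eq_mod_eq_0[THEN iffD2]) simp
qed

text \<open>Every scalar of the prime field is the image of an integer, so a subgroup is already a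
  subspace over it. Invariance under both x^e and x^(-e) extends this to Laurent polynomials in
  x^e.\<close>

lemma lamp_subspace:
  fixes U :: "('p::prime_card, 'n::finite) lamp set"
  assumes zero: "0 \<in> U" and diff: "\<And>a b. a \<in> U \<Longrightarrow> b \<in> U \<Longrightarrow> a - b \<in> U"
    and inv: "shift_invariant (int e) U"
  shows "Modules.module.subspace (lamp_action e) U"
proof -
  interpret Modules.module "lamp_action e :: _ \<Rightarrow> ('p, 'n) lamp \<Rightarrow> _" by (rule module_lamp_action)
  have uminus: "- a \<in> U" if "a \<in> U" for a using diff[OF zero that] by simp
  have add: "a + b \<in> U" if "a \<in> U" "b \<in> U" for a b using diff[OF that(1) uminus[OF that(2)]] by simp
  have scalar: "Poly_Mapping.single 0 c *s a \<in> U" if a: "a \<in> U" for c a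
  proof -
    have int: "(of_int i :: 'p laurent) *s a \<in> U" for i
    proof (induction i rule: int_induct[where k = 0])
      case base
      then show ?case using zero by simp
    next
      case (step1 i)
      then show ?case using add[OF step1(2) a] by (simp add: vector_sadd_rdistrib vector_smult_lid)
    next
      case (step2 i)
      then show ?case using diff[OF step2(2) a] by (simp add: vector_sub_rdistrib vector_smult_lid)
    qed
    have "c = of_int (to_int_mod_ring c)" by (simp add: of_int_of_int_mod_ring)
    then have "Poly_Mapping.single 0 c = (of_int (to_int_mod_ring c) :: 'p laurent)"
      by (metis single_of_int)
    then show ?thesis using int by simp
  qed
  have "lamp_action e r a \<in> U" if "a \<in> U" for r a
  proof (induction r rule: laurent_induct)
    case (add r s)
    then show ?case by (simp add: scale_left_distrib \<open>\<And>a b. a \<in> U \<Longrightarrow> b \<in> U \<Longrightarrow> a + b \<in> U\<close>)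
  next
    case (single k c)
    have "xpow (int e * k) *s a \<in> U"
      using shift_invariant_mult[OF inv] that by (simp add: shift_invariant_iff)
    from scalar[OF this, of c] show ?case
      by (simp add: lamp_action_single vector_smult_assoc mult_single)
  qed
  with zero add show ?thesis by (simp add: subspace_def)
qed

lemma cyclic_decomposition_iff:
  fixes U :: "('p::prime_card, 'n::finite) lamp set"
  assumes "Modules.module.subspace (lamp_action (the_enat (period U))) U"
  shows "cyclic_decomposition U qs \<longleftrightarrow>
    (\<forall>(q, r)\<in>set qs. 1 \<le> r \<and> (q = 0 \<or> irreducible q \<and> poly q 0 = 1)) \<and>
    (\<exists>L. cyclic_coordinates (lamp_action (the_enat (period U))) U L \<and>
      map fst L = map (\<lambda>(q, r). laurent_of_poly q ^ r) qs)"
  unfolding cyclic_decomposition_def lamp_module_eq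
    module_isomorphic_direct_sum_iff[OF module_lamp_action assms] by simp

text \<open>This ensures that the choice made in \<open>det_star\<close> is an actual
  decomposition.\<close>

lemma exists_cyclic_decomposition:
  fixes U :: "('p::prime_card, 'n::finite) lamp set"
  assumes "0 < the_enat (period U)" and U: "Modules.module.subspace (lamp_action (the_enat (period U))) U"
  shows "\<exists>qs. cyclic_decomposition U qs"
proof -
  obtain L where L: "\<forall>(d, c)\<in>set L. primary_modulus d"
    "cyclic_coordinates (lamp_action (the_enat (period U))) U L"
    using lamp_primary_coordinates[OF assms] by blast
  have "\<forall>d. \<exists>y. primary_modulus d \<longrightarrow> 1 \<le> snd y \<and> (fst y = 0 \<or> irreducible (fst y) \<and> poly (fst y) 0 = 1)
      \<and> d = laurent_of_poly (fst y) ^ snd y"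
    unfolding primary_modulus_def by auto
  then obtain f :: "'p laurent \<Rightarrow> 'p mod_ring poly \<times> nat" where f: "\<And>d. primary_modulus d \<Longrightarrow>
      1 \<le> snd (f d) \<and> (fst (f d) = 0 \<or> irreducible (fst (f d)) \<and> poly (fst (f d)) 0 = 1)
      \<and> d = laurent_of_poly (fst (f d)) ^ snd (f d)" by metis
  let ?qs = "map (\<lambda>(d, c). f d) L"
  have "map fst L = map (\<lambda>(q, r). laurent_of_poly q ^ r) ?qs"
    using L(1) f by (auto simp: case_prod_beta)
  moreover have "\<forall>(q, r)\<in>set ?qs. 1 \<le> r \<and> (q = 0 \<or> irreducible q \<and> poly q 0 = 1)"
    using L(1) f by (auto simp: case_prod_beta)
  ultimately show ?thesis using L(2) unfolding cyclic_decomposition_iff[OF U] by blast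
qed

section \<open>Determinants that are powers of 1 - x\<close>

lemma prod_list_power_cong:
  assumes "\<forall>x\<in>set xs. \<exists>j. f x = (b :: 'a::comm_monoid_mult) ^ j"
  shows "\<exists>j. prod_list (map f xs) = b ^ j"
  using assms
proof (induction xs)
  case Nil
  then show ?case by (intro exI[of _ 0]) simp
next
  case (Cons x xs)
  then obtain i j where "f x = b ^ i" "prod_list (map f xs) = b ^ j" by auto
  then show ?case by (intro exI[of _ "i + j"]) (simp add: power_add)
qed

lemma normalized_irreducible_dvd_linear:
  fixes q :: "('p::prime_card) mod_ring poly"
  assumes "irreducible q" and "poly q 0 = 1" and "q dvd [:1, -1:]"
  shows "q = [:1, -1:]"
proof -
  obtain g where g: "[:1, -1:] = q * g" using assms(3) ..
  have "q \<noteq> 0" "g \<noteq> 0" using g by auto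
  then have "degree q + degree g = 1" using arg_cong[OF g, of degree] by (simp add: degree_mult_eq)
  moreover have "degree q \<noteq> 0"
    using irreducible_not_unit[OF assms(1)] \<open>q \<noteq> 0\<close> by (simp add: is_unit_iff_degree)
  ultimately have "degree g = 0" by simp
  then obtain b where b: "g = [:b:]" by (metis degree_0_id)
  then have "b = 1" using arg_cong[OF g, of "\<lambda>f. poly f 0"] assms(2) by simp
  with g b show ?thesis by (simp add: one_pCons[symmetric])
qed

text \<open>An irreducible divisor of a power of x is associated to x and so vanishes at 0.\<close>

lemma normalized_irreducible_not_dvd_X_power:
  fixes q :: "('p::prime_card) mod_ring poly"
  assumes "irreducible q" and "poly q 0 = 1"
  shows "\<not> q dvd Polynomial.monom 1 n"
proof
  assume "q dvd Polynomial.monom 1 n"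
  then have "q dvd [:0, 1:] ^ n" by (simp add: monom_altdef)
  then have "q dvd [:0, 1:]"
    using assms(1) by (auto dest: prime_elem_dvd_power irreducible_imp_prime_elem)
  then obtain g where g: "[:0, 1:] = q * g" ..
  have "q \<noteq> 0" "g \<noteq> 0" using g by auto
  then have "degree q + degree g = 1" using arg_cong[OF g, of degree] by (simp add: degree_mult_eq)
  moreover have "degree q \<noteq> 0"
    using irreducible_not_unit[OF assms(1)] \<open>q \<noteq> 0\<close> by (simp add: is_unit_iff_degree)
  ultimately have "degree g = 0" by simp
  then obtain b where b: "g = [:b:]" by (metis degree_0_id)
  then have "b = 0" using arg_cong[OF g, of "\<lambda>f. poly f 0"] assms(2) by simp
  with b \<open>g \<noteq> 0\<close> show False by simp
qed

lemma laurent_of_poly_not_unit: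
  fixes q :: "('p::prime_card) mod_ring poly"
  assumes "irreducible q" and "poly q 0 = 1"
  shows "\<not> laurent_of_poly q dvd 1"
proof
  assume "laurent_of_poly q dvd 1"
  then obtain a where a: "1 = laurent_of_poly q * a" ..
  obtain k g where g: "a = xpow k * laurent_of_poly g" by (rule laurent_eq_xpow_mult_poly)
  have "laurent_of_poly (q * g) = xpow (- k) * (xpow k * (laurent_of_poly q * laurent_of_poly g))"
    by (simp add: laurent_of_poly_mult)
  also have "\<dots> = xpow (- k)" using a by (simp add: g mult.left_commute)
  finally have eq: "laurent_of_poly (q * g) = xpow (- k)" .
  \<comment> \<open>The coefficient of x^(-k) is 1 on the right, while the polynomial on the left
    has no negative exponents.\<close>
  have "0 \<le> - k"
    using arg_cong[OF eq, of "\<lambda>a. Poly_Mapping.lookup a (- k)"]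
    by (simp add: lookup_laurent_of_poly split: if_splits)
  then have "laurent_of_poly (q * g) = laurent_of_poly (Polynomial.monom 1 (nat (- k)))"
    using eq by simp
  then have "Polynomial.monom 1 (nat (- k)) = q * g" by (simp only: laurent_of_poly_eq_iff)
  then show False using normalized_irreducible_not_dvd_X_power[OF assms] by (metis dvd_triv_left)
qed

lemma dvd_prod_list: "x \<in> set xs \<Longrightarrow> x dvd prod_list (xs :: 'a::comm_monoid_mult list)"
  by (induction xs) auto

text \<open>If the product is a power of 1 - x, then every nonzero q divides that power and, being
  irreducible, divides 1 - x; the normalization at 0 fixes the constant factor.\<close>

lemma det_power_iff:
  fixes qs :: "(('p::prime_card) mod_ring poly \<times> nat) list"
  assumes qs: "\<forall>(q, r)\<in>set qs. 1 \<le> r \<and> (q = 0 \<or> irreducible q \<and> poly q 0 = 1)"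
  shows "(\<exists>j. prod_list (map (\<lambda>(q, r). q ^ r) (filter (\<lambda>(q, r). q \<noteq> 0) qs)) = [:1, -1:] ^ j)
    \<longleftrightarrow> (\<forall>(q, r)\<in>set qs. q = 0 \<or> q = [:1, -1:])"
    (is "?L \<longleftrightarrow> ?R")
proof
  assume ?L
  then obtain j where j: "prod_list (map (\<lambda>(q, r). q ^ r) (filter (\<lambda>(q, r). q \<noteq> 0) qs)) = [:1, -1:] ^ j" ..
  have "q = [:1, -1:]" if "(q, r) \<in> set qs" "q \<noteq> 0" for q r
  proof -
    have r: "1 \<le> r" and q: "irreducible q" "poly q 0 = 1" using qs that by auto
    have "q dvd q ^ r" using r by (intro dvd_power) simp
    also have "q ^ r dvd [:1, -1:] ^ j"
      unfolding j[symmetric] using that by (intro dvd_prod_list) (force simp: image_iff)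
    finally have "q dvd [:1, -1:]"
      using q(1) by (auto dest: prime_elem_dvd_power irreducible_imp_prime_elem)
    with q show ?thesis by (rule normalized_irreducible_dvd_linear)
  qed
  then show ?R by auto
next
  assume ?R
  then show ?L by (intro prod_list_power_cong) auto
qed

text \<open>In the coordinates \<open>c\<close> modulo \<open>d\<close> the closure of \<open>U\<close> consists of the vectors all of whose
  coordinates are divisible by all powers of \<open>x - 1\<close>: this kills coordinates modulo \<open>0\<close> and
  modulo powers of \<open>1 - x\<close>, and says nothing modulo any other irreducible.\<close>

lemma vector_closure_subset_iff:
  fixes U :: "('p::prime_card, 'n::finite) lamp set"
  assumes e: "e = CARD('p) ^ c0" and U: "Modules.module.subspace (lamp_action e) U"
    and qs: "\<forall>(q, r)\<in>set qs. 1 \<le> r \<and> (q = 0 \<or> irreducible q \<and> poly q 0 = 1)"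
    and L: "cyclic_coordinates (lamp_action e) U L" "map fst L = map (\<lambda>(q, r). laurent_of_poly q ^ r) qs"
  shows "vector_closure U \<subseteq> U \<longleftrightarrow> (\<forall>(q, r)\<in>set qs. q = 0 \<or> q = [:1, -1:])"
proof -
  interpret Modules.module "lamp_action e :: _ \<Rightarrow> ('p, 'n) lamp \<Rightarrow> _" by (rule module_lamp_action)
  have len: "length L = length qs" using L(2) by (metis length_map)
  define t :: "nat \<Rightarrow> 'p laurent" where "t m = xpow (int CARD('p) ^ m) - 1" for m
  have t_power: "t m = laurent_of_poly [:-1, 1:] ^ (CARD('p) ^ m)" for m
  proof -
    have "laurent_of_poly [:-1, 1:] = (xpow 1 - 1 :: 'p laurent)"
      by (rule poly_mapping_eqI)
        (auto simp: lookup_laurent_of_poly lookup_minus lookup_single lookup_one when_def coeff_pCons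
          split: nat.split)
    then show ?thesis by (simp only: t_def xpow_minus_one_power mult_1_right)
  qed
  \<comment> \<open>As e = p^c0, the element \<open>t m\<close> acts as x^(p^(c0 + m)) - 1, so it
    cuts out the congruence vectors of level c0 + m. These levels are cofinal.\<close>
  have closure_iff: "w \<in> vector_closure U \<longleftrightarrow> (\<forall>m. \<exists>b. w - lamp_action e (t m) b \<in> U)" for w
  proof -
    have t_action: "lamp_action e (t m) b = (xpow (int CARD('p) ^ (c0 + m)) - 1) *s b" for m and b :: "('p, 'n) lamp"
      by (simp add: lamp_action_def t_def push_exponents_diff e power_add)
    have "(\<exists>u\<in>U. w - u \<in> congruence_vectors (c0 + m)) \<longleftrightarrow> (\<exists>b. w - lamp_action e (t m) b \<in> U)" for m
    proof
      assume "\<exists>u\<in>U. w - u \<in> congruence_vectors (c0 + m)"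
      then obtain u b where "u \<in> U" "w - u = lamp_action e (t m) b"
        unfolding congruence_vectors_def multiples_def t_action by blast
      then have "w - lamp_action e (t m) b = u" by (simp add: algebra_simps)
      with \<open>u \<in> U\<close> show "\<exists>b. w - lamp_action e (t m) b \<in> U" by blast
    next
      assume "\<exists>b. w - lamp_action e (t m) b \<in> U"
      then obtain b where "w - lamp_action e (t m) b \<in> U" ..
      moreover have "w - (w - lamp_action e (t m) b) \<in> congruence_vectors (c0 + m)"
        unfolding congruence_vectors_def multiples_def t_action by simp
      ultimately show "\<exists>u\<in>U. w - u \<in> congruence_vectors (c0 + m)" by blast
    qed
    moreover have "w \<in> vector_closure U \<longleftrightarrow> (\<forall>m. \<exists>u\<in>U. w - u \<in> congruence_vectors (c0 + m))"
      unfolding vector_closure_def using congruence_vectors_antimono[of _ "c0 + m" m for m]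
      by (auto, meson le_add2)
    ultimately show ?thesis by simp
  qed
  have U_iff: "u \<in> U \<longleftrightarrow> (\<forall>(d, c)\<in>set L. d dvd c u)" for u
    using L(1) unfolding cyclic_coordinates_def by blast
  have coordinate: "d dvd c (w - lamp_action e r b) - (c w - r * c b)" if "(d, c) \<in> set L" for d c w r b
  proof -
    have "d dvd c ((w - lamp_action e r b) + lamp_action e r b)
        - (c (w - lamp_action e r b) + c (lamp_action e r b))" "d dvd c (lamp_action e r b) - r * c b"
      using L(1) that unfolding cyclic_coordinates_def by blast+
    from dvd_add[OF this] have "d dvd c w - c (w - lamp_action e r b) - r * c b" by (simp add: algebra_simps)
    then have "d dvd - (c w - c (w - lamp_action e r b) - r * c b)" by (simp only: dvd_minus_iff)
    then show ?thesis by (simp add: algebra_simps)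
  qed
  have coordinate_iff: "d dvd c (w - lamp_action e r b) \<longleftrightarrow> d dvd c w - r * c b"
    if "(d, c) \<in> set L" for d c w r b
    using dvd_add_right_iff[OF coordinate[OF that, of w r b], of "c w - r * c b"] by simp
  show ?thesis
  proof
    assume closed: "vector_closure U \<subseteq> U"
    have "q = 0 \<or> q = [:1, -1:]" if "i < length qs" "qs ! i = (q, r)" for i q r
    proof (rule ccontr)
      assume "\<not> (q = 0 \<or> q = [:1, -1:])"
      then have "q \<noteq> 0" "q \<noteq> [:1, -1:]" by auto
      have "1 \<le> r" and q: "irreducible q" "poly q 0 = 1"
        using qs that nth_mem[OF that(1)] \<open>q \<noteq> 0\<close> by auto
      have "\<not> q dvd [:1, -1:]"
        using normalized_irreducible_dvd_linear[OF q] \<open>q \<noteq> [:1, -1:]\<close> by blast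
      then have "\<not> q dvd - [:1, -1:]" by (simp only: dvd_minus_iff) simp
      then have "coprime q [:-1, 1:]"
        using q(1) by (simp add: prime_elem_imp_coprime irreducible_imp_prime_elem)
      then have coprime: "coprime (q ^ r) ([:-1, 1:] ^ k)" for k by simp
      define D where "D = laurent_of_poly q ^ r"
      define c where "c = snd (L ! i)"
      have "fst (L ! i) = D"
        using arg_cong[OF L(2), of "\<lambda>xs. xs ! i"] that len by (simp add: D_def)
      then have L_i: "L ! i = (D, c)" by (simp add: c_def prod_eq_iff)
      then have in_L: "(D, c) \<in> set L" using that len by (metis nth_mem)
      \<comment> \<open>The vector a with coordinate 1 in place i and 0 elsewhere will lie in the
        closure of U but not in U.\<close>
      define gs where "gs = (replicate (length L) 0)[i := 1 :: 'p laurent]"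
      have "length gs = length L" by (simp add: gs_def)
      then obtain a where a: "list_all2 (\<lambda>(d, c) g. d dvd c a - g) L gs"
        using L(1) unfolding cyclic_coordinates_def by blast
      have a_i: "D dvd c a - 1"
        using list_all2_nthD[OF a, of i] that len L_i by (simp add: gs_def)
      have "\<exists>b. a - lamp_action e (t m) b \<in> U" for m
      proof -
        obtain s s' where "s * q ^ r + s' * [:-1, 1:] ^ (CARD('p) ^ m) = 1"
          using coprime by (metis bezout_coefficients_fst_snd coprime_iff_gcd_eq_1)
        from arg_cong[OF this, of laurent_of_poly]
        have bezout: "laurent_of_poly s * D + laurent_of_poly s' * t m = 1"
          by (simp add: laurent_of_poly_add laurent_of_poly_mult laurent_of_poly_power D_def t_power)
        \<comment> \<open>Modulo D the factor s' inverts \<open>t m\<close>, so subtracting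
          \<open>t m\<close> times s' a kills the i-th coordinate. The other coordinates of a are
          already 0.\<close>
        let ?b = "lamp_action e (laurent_of_poly s') a"
        have "a - lamp_action e (t m) ?b \<in> U"
          unfolding U_iff
        proof (intro ballI, unfold split_paired_all case_prod_conv)
          fix d' c'
          assume "(d', c') \<in> set L"
          then obtain k where k: "k < length L" "L ! k = (d', c')" by (metis in_set_conv_nth)
          have "d' dvd c' a - (t m * laurent_of_poly s') * c' a"
          proof (cases "k = i")
            case True
            then have "d' = D" "c' = c" using k L_i by auto
            moreover have "c a - (t m * laurent_of_poly s') * c a = D * (laurent_of_poly s * c a)
              + c a * (1 - (laurent_of_poly s * D + laurent_of_poly s' * t m))"
              by (simp add: algebra_simps)
            ultimately show ?thesis by (simp add: bezout)
          next
            case False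
            then have "d' dvd c' a" using list_all2_nthD[OF a k(1)] k by (simp add: gs_def)
            then show ?thesis by (intro dvd_diff dvd_mult)
          qed
          then show "d' dvd c' (a - lamp_action e (t m) ?b)"
            using coordinate_iff[OF \<open>(d', c') \<in> set L\<close>, of a "t m * laurent_of_poly s'" a]
            by simp
        qed
        then show ?thesis ..
      qed
      then have "a \<in> U" using closed closure_iff by blast
      then have "D dvd c a" using in_L U_iff by blast
      with a_i have "D dvd c a - (c a - 1)" by (rule dvd_diff[rotated])
      then have "D dvd 1" by simp
      moreover have "laurent_of_poly q dvd D" unfolding D_def using \<open>1 \<le> r\<close> by (intro dvd_power) simp
      ultimately show False using laurent_of_poly_not_unit[OF q] by (metis dvd_trans)
    qed
    then show "\<forall>(q, r)\<in>set qs. q = 0 \<or> q = [:1, -1:]" by (force simp: in_set_conv_nth)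
  next
    assume *: "\<forall>(q, r)\<in>set qs. q = 0 \<or> q = [:1, -1:]"
    show "vector_closure U \<subseteq> U"
    proof
      fix w
      assume w: "w \<in> vector_closure U"
      show "w \<in> U"
        unfolding U_iff
      proof (intro ballI, unfold split_paired_all case_prod_conv)
        fix d c
        assume dc: "(d, c) \<in> set L"
        then have "d \<in> set (map fst L)" by force
        then obtain q r where qr: "(q, r) \<in> set qs" "d = laurent_of_poly q ^ r" unfolding L(2) by auto
        have dvd: "\<exists>y. d dvd c w - t m * y" for m
          using w dc unfolding closure_iff U_iff by (metis (no_types, lifting) case_prodD coordinate_iff)
        show "d dvd c w"
        proof (cases "q = 0")
          case True
          then have "d = 0" using qs qr by auto
          then have "t m dvd c w" for m using dvd[of m] by auto
          then have "c w = 0" unfolding t_def by (rule laurent_separated)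
          then show ?thesis by simp
        next
          case False
          then have "q = [:1, -1:]" using * qr by auto
          then have "q = - [:-1, 1:]" by simp
          then have "q dvd [:-1, 1:]" by (simp only: minus_dvd_iff dvd_refl)
          then obtain g where g: "[:-1, 1:] = q * g" ..
          \<comment> \<open>Once p^m is at least r, the modulus d divides \<open>t m\<close> = (x -
            1)^(p^m), so approximation at this single level decides divisibility by d.\<close>
          obtain m where m: "r \<le> CARD('p) ^ m" using exists_power_CARD_ge by blast
          have "laurent_of_poly q dvd laurent_of_poly [:-1, 1:]" unfolding g laurent_of_poly_mult by simp
          then have "laurent_of_poly q ^ r dvd laurent_of_poly [:-1, 1:] ^ (CARD('p) ^ m)"
            using m by (meson dvd_trans dvd_power_same le_imp_power_dvd)
          then have "d dvd t m" by (simp only: qr t_power)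
          moreover obtain y where "d dvd c w - t m * y" using dvd by blast
          ultimately have "d dvd (c w - t m * y) + t m * y" by (intro dvd_add dvd_mult2)
          then show ?thesis by simp
        qed
      qed
    qed
  qed
qed

text \<open>A divisor of p^d is a power of p, as the coordinate criterion requires. That criterion
  holds for every decomposition, hence for the one chosen in \<open>det_star\<close>.\<close>

lemma vector_closure_subset_iff_det_star:
  fixes U :: "('p::prime_card, 'n::finite) lamp set"
  assumes "0 \<in> U" and "\<And>a b. a \<in> U \<Longrightarrow> b \<in> U \<Longrightarrow> a - b \<in> U"
    and "period U \<noteq> \<infinity>" and dvd: "the_enat (period U) dvd CARD('p) ^ d"
  shows "vector_closure U \<subseteq> U \<longleftrightarrow> (\<exists>j. det_star U = [:1, -1:] ^ j)"
proof -
  note period = period_minimal[OF assms(3)]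
  have U: "Modules.module.subspace (lamp_action (the_enat (period U))) U"
    using assms(1,2) period(2) by (rule lamp_subspace)
  define qs where "qs = (SOME qs. cyclic_decomposition U qs)"
  have "cyclic_decomposition U qs"
    unfolding qs_def using exists_cyclic_decomposition[OF period(1) U] by (rule someI_ex)
  then obtain L where qs: "\<forall>(q, r)\<in>set qs. 1 \<le> r \<and> (q = 0 \<or> irreducible q \<and> poly q 0 = 1)"
    and L: "cyclic_coordinates (lamp_action (the_enat (period U))) U L"
      "map fst L = map (\<lambda>(q, r). laurent_of_poly q ^ r) qs"
    unfolding cyclic_decomposition_iff[OF U] by blast
  obtain c where c: "the_enat (period U) = CARD('p) ^ c"
    using dvd divides_primepow_nat[OF prime_card] by blast
  have "det_star U = prod_list (map (\<lambda>(q, r). q ^ r) (filter (\<lambda>(q, r). q \<noteq> 0) qs))"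
    by (simp add: det_star_def qs_def)
  then show ?thesis
    using det_power_iff[OF qs] vector_closure_subset_iff[OF c U qs L] by simp
qed

section \<open>Subgroups of the lamplighter group\<close>

text \<open>The sum of the first t powers of x^j stands for the quotient (x^(jt) - 1)/(x^j - 1). It
  preserves U because each power of x^j does.\<close>

lemma geometric_multiplier:
  fixes U :: "('p::prime_card, 'n::finite) lamp set" and t :: nat
  assumes zero: "0 \<in> U" and diff: "\<And>a b. a \<in> U \<Longrightarrow> b \<in> U \<Longrightarrow> a - b \<in> U"
    and inv: "shift_invariant j U"
  shows "\<exists>G. (xpow j - 1) * G = xpow (j * int t) - 1 \<and> (\<forall>u\<in>U. G *s u \<in> U)"
proof (intro exI conjI ballI)
  let ?G = "\<lambda>t. \<Sum>i<t. xpow j ^ i :: 'p laurent"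
  show "(xpow j - 1) * ?G t = xpow (j * int t) - 1"
    using power_diff_1_eq[of "xpow j :: 'p laurent" t] by (simp add: xpow_power mult.commute)
  fix u
  assume u: "u \<in> U"
  have add: "a + b \<in> U" if "a \<in> U" "b \<in> U" for a b
    using diff[OF that(1) diff[OF zero that(2)]] by simp
  show "?G t *s u \<in> U"
  proof (induction t)
    case 0
    then show ?case using zero by simp
  next
    case (Suc t)
    have "xpow j ^ t *s u \<in> U"
      using shift_invariant_mult[OF inv, of "int t"] u
      by (simp add: shift_invariant_iff xpow_power mult.commute)
    with Suc show ?case by (simp add: vector_sadd_rdistrib add)
  qed
qed

text \<open>Writing s = p^d s' with s' prime to p, one takes for t an inverse of s' modulo
  p^m.\<close>

lemma exists_multiple_cong_power:
  assumes "0 < s" and "prime p"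
  shows "\<exists>t::nat. int p ^ m dvd int s * int t - int p ^ multiplicity p s"
proof -
  let ?d = "multiplicity p s"
  obtain s' where s': "s = p ^ ?d * s'" "\<not> p dvd s'"
    using multiplicity_decompose'[of s p] assms by (metis not_prime_unit neq0_conv)
  then have "coprime s' (p ^ m)"
    using assms(2) by (simp add: prime_imp_coprime coprime_commute)
  then obtain t where "[s' * t = 1] (mod p ^ m)" by (metis cong_solve_coprime_nat One_nat_def)
  then have "int p ^ m dvd int s' * int t - 1"
    by (metis cong_iff_dvd_diff cong_int_iff of_nat_1 of_nat_mult of_nat_power)
  then have "int p ^ m dvd int p ^ ?d * (int s' * int t - 1)" by simp
  also have "int p ^ ?d * (int s' * int t - 1) = int (p ^ ?d * s') * int t - int p ^ ?d"
    by (simp add: algebra_simps)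
  finally show ?thesis using s'(1) by metis
qed

section \<open>A subgroup described by its vectors at each exponent\<close>

locale lamplighter_subgroup =
  fixes V :: "(('p::prime_card, 'n::finite) lamp \<times> int) set"
    and s :: nat
    and V0 :: "('p, 'n) lamp set"
    and v :: "('p, 'n) lamp"
    and d :: nat
  assumes subgroup: "subgroup V lamplighter"
    and triple: "subgroup_triple V s V0 v"
    and d_eq: "d = multiplicity CARD('p) s"
begin

lemma V0_iff: "u \<in> V0 \<longleftrightarrow> (u, 0) \<in> V"
  using triple by (simp add: subgroup_triple_def)

lemma V_mult: "(a, j) \<in> V \<Longrightarrow> (b, k) \<in> V \<Longrightarrow> (a + xpow j *s b, j + k) \<in> V"
  using subgroup.m_closed[OF subgroup] by fastforce

lemma V_inv: "(a, j) \<in> V \<Longrightarrow> (- (xpow (- j) *s a), - j) \<in> V"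
  using subgroup.m_inv_closed[OF subgroup] by fastforce

lemma v_in_V: "(v, int s) \<in> V"
  using triple by (simp add: subgroup_triple_def)

lemma V0_zero: "0 \<in> V0"
  using subgroup.one_closed[OF subgroup] by (simp add: V0_iff)

lemma V_diff: "(a, j) \<in> V \<Longrightarrow> (b, j) \<in> V \<Longrightarrow> a - b \<in> V0"
  using V_mult[OF _ V_inv, of a j b j] by (simp add: V0_iff vector_smult_rneg vector_smult_assoc xpow_mult vector_smult_lid)

lemma V0_diff: "a \<in> V0 \<Longrightarrow> b \<in> V0 \<Longrightarrow> a - b \<in> V0"
  using V_diff[of a 0 b] by (simp add: V0_iff)

lemma V0_uminus: "a \<in> V0 \<Longrightarrow> - a \<in> V0"
  using V0_diff[OF V0_zero] by simp

lemma V_add_V0: "(a, j) \<in> V \<Longrightarrow> u \<in> V0 \<Longrightarrow> (a + u, j) \<in> V"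
  using V_mult[of u 0 a j] by (simp add: V0_iff vector_smult_lid add.commute)

lemma V_exponent: "(a, j) \<in> V \<Longrightarrow> \<exists>k. j = int s * k"
  using triple unfolding subgroup_triple_def by (metis imageI rangeE snd_conv)

text \<open>The elements (v, s)(u, 0) and (v, s) of V have the same exponent and vectors differing
  by x^s u. The inverse of (v, s) gives x^(-s) u in the same way.\<close>

lemma shift_invariant_s: "shift_invariant (int s) V0"
  unfolding shift_invariant_iff
proof
  fix u
  assume "u \<in> V0"
  then have u: "(u, 0) \<in> V" by (simp add: V0_iff)
  have "v + xpow (int s) *s u - v \<in> V0"
    using V_diff[OF V_mult[OF v_in_V u, simplified] v_in_V] .
  moreover have "(- (xpow (- int s) *s v) + xpow (- int s) *s u, - int s) \<in> V"
    using V_mult[OF V_inv[OF v_in_V] u] by simp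
  from V_diff[OF this V_inv[OF v_in_V]] have "xpow (- int s) *s u \<in> V0" by simp
  ultimately show "xpow (int s) *s u \<in> V0 \<and> xpow (- int s) *s u \<in> V0" by simp
qed

text \<open>The vectors occurring in \<open>V\<close> at level \<open>s k\<close> are those congruent modulo \<open>V\<^sub>0\<close> to
  \<open>((x\<^sup>s\<^sup>k - 1) / (x\<^sup>s - 1)) v\<close>.\<close>

lemma exists_level:
  "\<exists>w. (w, int s * k) \<in> V \<and> (xpow (int s) - 1) *s w = (xpow (int s * k) - 1) *s v"
proof (induction k rule: int_induct[where k = 0])
  case base
  then show ?case using V0_zero by (intro exI[of _ 0]) (simp add: V0_iff)
next
  case (step1 k)
  then obtain w where w: "(w, int s * k) \<in> V" "(xpow (int s) - 1) *s w = (xpow (int s * k) - 1) *s v"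
    by blast
  have "(xpow (int s) - 1) *s (v + xpow (int s) *s w)
    = (xpow (int s) - 1) *s v + xpow (int s) *s ((xpow (int s) - 1) *s w)"
    by (simp add: vec_eq_iff algebra_simps)
  also have "\<dots> = (xpow (int s * (k + 1)) - 1) *s v"
    unfolding w(2) by (simp add: vec_eq_iff algebra_simps xpow_mult flip: mult.assoc)
  finally show ?case using V_mult[OF v_in_V w(1)] by (auto simp: algebra_simps)
next
  case (step2 k)
  then obtain w where w: "(w, int s * k) \<in> V" "(xpow (int s) - 1) *s w = (xpow (int s * k) - 1) *s v"
    by blast
  let ?w = "- (xpow (- int s) *s v) + xpow (- int s) *s w"
  have "(xpow (int s) - 1) *s ?w
    = xpow (- int s) *s ((xpow (int s) - 1) *s w - (xpow (int s) - 1) *s v)"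
    by (simp add: vec_eq_iff algebra_simps)
  also have "\<dots> = (xpow (int s * (k - 1)) - 1) *s v"
    unfolding w(2) by (simp add: vec_eq_iff algebra_simps xpow_mult flip: mult.assoc)
  finally show ?case using V_mult[OF V_inv[OF v_in_V] w(1)] by (auto simp: algebra_simps)
qed

text \<open>The equation is kept exactly and not just modulo V0, which lets x^s - 1 be cleared
  uniformly for positive and negative k.\<close>

definition level :: "int \<Rightarrow> ('p, 'n) lamp" where
  "level k = (SOME w. (w, int s * k) \<in> V \<and> (xpow (int s) - 1) *s w = (xpow (int s * k) - 1) *s v)"

lemma level_in_V: "(level k, int s * k) \<in> V"
  and level_eq: "(xpow (int s) - 1) *s level k = (xpow (int s * k) - 1) *s v"
  using someI_ex[OF exists_level[of k]] by (simp_all add: level_def)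

lemma in_V_level_iff: "(a, int s * k) \<in> V \<longleftrightarrow> a - level k \<in> V0"
  using V_diff[OF _ level_in_V[of k], of a] V_add_V0[OF level_in_V, of "a - level k" k] by auto

text \<open>The vectors of V over the exponent s k form the coset of V0 through
  \<open>level k\<close>, so approximation by V separates into a choice of k and of an element of
  V0.\<close>

lemma closedin_iff: "closedin (pro_p_topology CARD('p) lamplighter) V \<longleftrightarrow>
    (\<forall>a j. (\<forall>m. \<exists>k. \<exists>u\<in>V0. a - level k - u \<in> congruence_vectors m \<and> int CARD('p) ^ m dvd j - int s * k)
      \<longrightarrow> (a, j) \<in> V)"
proof -
  have "(\<exists>h\<in>V. lamp_cong m (a, j) h) \<longleftrightarrow>
    (\<exists>k. \<exists>u\<in>V0. a - level k - u \<in> congruence_vectors m \<and> int CARD('p) ^ m dvd j - int s * k)" for a j m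
  proof
    assume "\<exists>h\<in>V. lamp_cong m (a, j) h"
    then obtain b l where b: "(b, l) \<in> V" "a - b \<in> congruence_vectors m" "int CARD('p) ^ m dvd j - l"
      by (auto simp: lamp_cong_def)
    obtain k where k: "l = int s * k" using V_exponent[OF b(1)] ..
    then have "b - level k \<in> V0" using b(1) in_V_level_iff by simp
    moreover have "a - level k - (b - level k) = a - b" by simp
    ultimately show "\<exists>k. \<exists>u\<in>V0. a - level k - u \<in> congruence_vectors m \<and> int CARD('p) ^ m dvd j - int s * k"
      using b k by metis
  next
    assume "\<exists>k. \<exists>u\<in>V0. a - level k - u \<in> congruence_vectors m \<and> int CARD('p) ^ m dvd j - int s * k"
    then obtain k u where u: "u \<in> V0" "a - level k - u \<in> congruence_vectors m" "int CARD('p) ^ m dvd j - int s * k"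
      by blast
    then have "(level k + u, int s * k) \<in> V" by (simp add: in_V_level_iff)
    with u(2,3) show "\<exists>h\<in>V. lamp_cong m (a, j) h"
      by (intro bexI[of _ "(level k + u, int s * k)"]) (simp_all add: lamp_cong_def algebra_simps)
  qed
  then show ?thesis unfolding closedin_pro_p_topology_iff by (simp add: split_paired_all)
qed

lemma closed_imp_closed_V0:
  assumes "closedin (pro_p_topology CARD('p) lamplighter) V"
  shows "vector_closure V0 \<subseteq> V0"
proof
  fix w
  assume w: "w \<in> vector_closure V0"
  have "\<exists>k. \<exists>u\<in>V0. w - level k - u \<in> congruence_vectors m \<and> int CARD('p) ^ m dvd 0 - int s * k" for m
  proof -
    obtain u where u: "u \<in> V0" "w - u \<in> congruence_vectors m" using w by (auto simp: vector_closure_def)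
    \<comment> \<open>\<open>level 0\<close> is only known to lie in V0, so the approximant is
      corrected by it.\<close>
    have "level 0 \<in> V0" using level_in_V[of 0] by (simp add: V0_iff)
    then have "u - level 0 \<in> V0" using u(1) by (rule V0_diff[rotated])
    then show ?thesis using u(2) by (intro exI[of _ 0] bexI[of _ "u - level 0"]) simp_all
  qed
  then show "w \<in> V0" using assms unfolding closedin_iff V0_iff by blast
qed

lemma power_dvd_all_imp_zero:
  assumes "\<And>m. int CARD('p) ^ m dvd j"
  shows "j = 0"
proof (rule ccontr)
  assume "j \<noteq> 0"
  obtain m where "nat \<bar>j\<bar> + 1 \<le> CARD('p) ^ m" using exists_power_CARD_ge by blast
  then have "\<bar>j\<bar> < int CARD('p) ^ m" unfolding of_nat_power[symmetric] by linarith
  moreover have "int CARD('p) ^ m \<le> \<bar>j\<bar>" using assms[of m] \<open>j \<noteq> 0\<close> by (intro dvd_imp_le_int[of j "int CARD('p) ^ m", simplified])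
  ultimately show False by simp
qed

text \<open>All exponents in V are 0 here, and 0 is the only integer divisible by every power of p.
  Each \<open>level k\<close> then lies in V0, so only congruences of vectors remain.\<close>

lemma closedin_iff_zero:
  assumes "s = 0"
  shows "closedin (pro_p_topology CARD('p) lamplighter) V \<longleftrightarrow> vector_closure V0 \<subseteq> V0"
proof
  assume closed: "vector_closure V0 \<subseteq> V0"
  show "closedin (pro_p_topology CARD('p) lamplighter) V"
    unfolding closedin_iff
  proof (intro allI impI)
    fix a j
    assume *: "\<forall>m. \<exists>k. \<exists>u\<in>V0. a - level k - u \<in> congruence_vectors m \<and> int CARD('p) ^ m dvd j - int s * k"
    then have "int CARD('p) ^ m dvd j" for m using assms by auto
    then have "j = 0" by (rule power_dvd_all_imp_zero)
    have "level k \<in> V0" for k using level_in_V[of k] assms by (simp add: V0_iff)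
    then have "level k + u \<in> V0" if "u \<in> V0" for k u
      using that V_add_V0 V0_iff by blast
    then have "a \<in> vector_closure V0"
      using * unfolding vector_closure_def mem_Collect_eq by (metis diff_diff_eq)
    with closed show "(a, j) \<in> V" using \<open>j = 0\<close> V0_iff by blast
  qed
qed (rule closed_imp_closed_V0)

text \<open>With s t congruent to p^d modulo p^m, take G = (x^(st) - 1)/(x^s - 1). Then (x^s - 1) G
  is x^(st) - 1, which agrees with x^(p^d) - 1 at level m.\<close>

lemma exists_power_multiplier:
  assumes "0 < s"
  shows "\<exists>G. xpow (int CARD('p) ^ m) - 1 dvd (xpow (int s) - 1) * G - (xpow (int CARD('p) ^ d) - 1) \<and>
    (\<forall>u\<in>V0. G *s u \<in> V0)"
proof -
  obtain t where t: "int CARD('p) ^ m dvd int s * int t - int CARD('p) ^ d"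
    using exists_multiple_cong_power[OF assms prime_card] unfolding d_eq by blast
  obtain G where G: "(xpow (int s) - 1) * G = xpow (int s * int t) - 1" "\<And>u. u \<in> V0 \<Longrightarrow> G *s u \<in> V0"
    using geometric_multiplier[OF V0_zero V0_diff shift_invariant_s, of t] by blast
  show ?thesis
  proof (intro exI conjI ballI)
    show "xpow (int CARD('p) ^ m) - 1 dvd (xpow (int s) - 1) * G - (xpow (int CARD('p) ^ d) - 1)"
      unfolding G(1) using xpow_diff_dvd[OF t, where ?'p = 'p] by simp
    show "G *s u \<in> V0" if "u \<in> V0" for u
      using that by (rule G(2))
  qed
qed

text \<open>Cancelling (x - 1)^(p^d) costs p^d powers of x - 1. The level m + d + 1 suffices because
  p^d + p^m is at most 2 p^(m+d), hence at most p^(m+d+1).\<close>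

lemma power_cancel:
  fixes b :: "('p, 'n) lamp"
  assumes "(xpow (int CARD('p) ^ d) - 1) *s b \<in> congruence_vectors (m + d + 1)"
  shows "b \<in> congruence_vectors m"
proof -
  have "1 < CARD('p)" by (metis prime_card prime_gt_1_nat)
  then have "CARD('p) ^ d \<le> CARD('p) ^ (m + d)" "CARD('p) ^ m \<le> CARD('p) ^ (m + d)"
    by (simp_all add: power_increasing)
  then have "CARD('p) ^ d + CARD('p) ^ m \<le> 2 * CARD('p) ^ (m + d)" by simp
  also have "\<dots> \<le> CARD('p) ^ (m + d + 1)" using \<open>1 < CARD('p)\<close> by simp
  finally have le: "CARD('p) ^ d + CARD('p) ^ m \<le> CARD('p) ^ (m + d + 1)" .
  have "Poly_Mapping.lookup (xpow 1 - 1 :: 'p laurent) 1 = 1" by (simp add: lookup_minus lookup_one)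
  then have "xpow 1 - 1 \<noteq> (0 :: 'p laurent)" by (metis lookup_zero zero_neq_one)
  then show ?thesis
    using assms le unfolding congruence_vectors_eq_power
    using multiples_power_cancel[of "xpow 1 - 1 :: 'p laurent" "CARD('p) ^ d" b "CARD('p) ^ (m + d + 1)" "CARD('p) ^ m"]
    by (simp only: xpow_minus_one_power mult_1_right) simp
qed

text \<open>Multiplying by G replaces x^s - 1 by x^(p^d) - 1 up to an error of the given level,
  after which \<open>power_cancel\<close> applies.\<close>

lemma s_cancel:
  fixes b :: "('p, 'n) lamp"
  assumes "0 < s" and b: "(xpow (int s) - 1) *s b \<in> congruence_vectors (m + d + 1)"
  shows "b \<in> congruence_vectors m"
proof -
  obtain G where G: "xpow (int CARD('p) ^ (m + d + 1)) - 1 dvd (xpow (int s) - 1) * G - (xpow (int CARD('p) ^ d) - 1)"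
    "\<And>u. u \<in> V0 \<Longrightarrow> G *s u \<in> V0"
    using exists_power_multiplier[OF assms(1), of "m + d + 1"] by blast
  have "((xpow (int s) - 1) * G - (xpow (int CARD('p) ^ d) - 1)) *s b \<in> congruence_vectors (m + d + 1)"
    unfolding congruence_vectors_def using G(1) by (rule smult_multiples)
  then have "G *s ((xpow (int s) - 1) *s b) - ((xpow (int s) - 1) * G - (xpow (int CARD('p) ^ d) - 1)) *s b
      \<in> congruence_vectors (m + d + 1)"
    by (rule congruence_vectors_diff[OF congruence_vectors_smult[OF b]])
  also have "G *s ((xpow (int s) - 1) *s b) - ((xpow (int s) - 1) * G - (xpow (int CARD('p) ^ d) - 1)) *s b
      = (xpow (int CARD('p) ^ d) - 1) *s b"
    by (simp add: vec_eq_iff algebra_simps)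
  finally show ?thesis by (rule power_cancel)
qed

text \<open>If s t is congruent to p^d modulo p^m, then x^(st) u lies in V0 and agrees with x^(p^d)
  u at level m. The factor c, set to 1 and -1 at the end, covers both directions of the
  shift.\<close>

lemma closed_imp_shift_invariant:
  assumes "0 < s" and closed: "closedin (pro_p_topology CARD('p) lamplighter) V"
  shows "shift_invariant (int CARD('p) ^ d) V0"
proof -
  have "xpow (c * int CARD('p) ^ d) *s u \<in> V0" if "u \<in> V0" for u c
  proof -
    have "\<exists>u'\<in>V0. xpow (c * int CARD('p) ^ d) *s u - u' \<in> congruence_vectors m" for m
    proof -
      obtain t where t: "int CARD('p) ^ m dvd int s * int t - int CARD('p) ^ d"
        using exists_multiple_cong_power[OF assms(1) prime_card] unfolding d_eq by blast
      have "xpow (int s * (c * int t)) *s u \<in> V0"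
        using shift_invariant_mult[OF shift_invariant_s] \<open>u \<in> V0\<close> by (simp add: shift_invariant_iff)
      moreover have "int CARD('p) ^ m dvd - c * (int s * int t - int CARD('p) ^ d)" using t by (rule dvd_mult)
      then have "int CARD('p) ^ m dvd c * int CARD('p) ^ d - int s * (c * int t)" by (simp add: algebra_simps)
      then have "(xpow (c * int CARD('p) ^ d) - xpow (int s * (c * int t))) *s u \<in> congruence_vectors m"
        by (rule xpow_diff_smult_congruence_vectors)
      ultimately show ?thesis by (auto simp: vector_sub_rdistrib)
    qed
    then show ?thesis using closed_imp_closed_V0[OF closed] by (auto simp: vector_closure_def)
  qed
  from this[of _ 1] this[of _ "- 1"] show ?thesis by (simp add: shift_invariant_iff)
qed

text \<open>A forbidden relation puts (a, q) into the closure of V, hence into V, so that s would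
  divide q although 0 < q < s. The approximating vectors are \<open>level k\<close> - G u.\<close>

lemma closed_imp_not_in:
  assumes "0 < s" and closed: "closedin (pro_p_topology CARD('p) lamplighter) V"
    and q: "0 < q" "q < s" "d \<le> multiplicity CARD('p) q" and u: "u \<in> V0"
  shows "(xpow (int q) - 1) *s v \<noteq> (xpow (int s) - 1) *s a + (xpow (int CARD('p) ^ d) - 1) *s u"
proof
  assume eq: "(xpow (int q) - 1) *s v = (xpow (int s) - 1) *s a + (xpow (int CARD('p) ^ d) - 1) *s u"
  obtain q' where q': "int q = int CARD('p) ^ d * q'"
    using multiplicity_dvd'[OF q(3)] by (metis dvdE of_nat_dvd_iff of_nat_power)
  have "\<exists>k. \<exists>u\<in>V0. a - level k - u \<in> congruence_vectors m \<and> int CARD('p) ^ m dvd int q - int s * k" for m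
  proof -
    let ?l = "m + d + 1"
    obtain t where t: "int CARD('p) ^ ?l dvd int s * int t - int CARD('p) ^ d"
      using exists_multiple_cong_power[OF assms(1) prime_card] unfolding d_eq by blast
    \<comment> \<open>Since s t approximates p^d, the exponent s t q' approximates p^d q' =
      q.\<close>
    let ?k = "int t * q'"
    have "int CARD('p) ^ ?l dvd - q' * (int s * int t - int CARD('p) ^ d)" using t by (rule dvd_mult)
    then have k: "int CARD('p) ^ ?l dvd int q - int s * ?k" by (simp add: q' algebra_simps)
    obtain G where G: "xpow (int CARD('p) ^ ?l) - 1 dvd (xpow (int s) - 1) * G - (xpow (int CARD('p) ^ d) - 1)"
      "\<And>u. u \<in> V0 \<Longrightarrow> G *s u \<in> V0"
      using exists_power_multiplier[OF assms(1), of "m + d + 1"] by blast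
    \<comment> \<open>Congruence is checked after multiplication by x^s - 1, where
      \<open>level_eq\<close> and the relation for a apply; \<open>s_cancel\<close> then removes the
      factor.\<close>
    have "(xpow (int s) - 1) *s (a - level ?k - (- (G *s u)))
      = (xpow (int s) - 1) *s a + (xpow (int s) - 1) *s (G *s u) - (xpow (int s) - 1) *s level ?k"
      by (simp add: vec_eq_iff algebra_simps)
    also have "\<dots> = (xpow (int q) - xpow (int s * ?k)) *s v
        + ((xpow (int s) - 1) * G - (xpow (int CARD('p) ^ d) - 1)) *s u"
    proof -
      have "(xpow (int s) - 1) *s a = (xpow (int q) - 1) *s v - (xpow (int CARD('p) ^ d) - 1) *s u"
        unfolding eq by simp
      then show ?thesis unfolding level_eq by (simp add: vec_eq_iff algebra_simps)
    qed
    also have "\<dots> \<in> congruence_vectors ?l"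
    proof (rule congruence_vectors_add)
      show "(xpow (int q) - xpow (int s * ?k)) *s v \<in> congruence_vectors ?l"
        using k by (rule xpow_diff_smult_congruence_vectors)
      show "((xpow (int s) - 1) * G - (xpow (int CARD('p) ^ d) - 1)) *s u \<in> congruence_vectors ?l"
        unfolding congruence_vectors_def using G(1) by (rule smult_multiples)
    qed
    finally have "a - level ?k - (- (G *s u)) \<in> congruence_vectors m"
      by (rule s_cancel[OF assms(1)])
    moreover have "int CARD('p) ^ m dvd int q - int s * ?k"
      using k by (rule dvd_trans[rotated]) (simp add: le_imp_power_dvd)
    ultimately show ?thesis using V0_uminus[OF G(2)[OF u]] by blast
  qed
  then have "(a, int q) \<in> V" using closed unfolding closedin_iff by blast
  then have "s dvd q" using V_exponent by (metis dvd_triv_left of_nat_dvd_iff)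
  with q(1,2) show False by (meson dvd_imp_le leD)
qed

text \<open>For (w, j) in the closure, b = (x^j - 1) v - (x^s - 1) w lies in (y - 1) V0 because V0
  is closed. If s does not divide j, this becomes a forbidden relation at j mod s; otherwise it
  places w in the coset of V0 belonging to j.\<close>

lemma closedinI:
  assumes "0 < s" and inv: "shift_invariant (int CARD('p) ^ d) V0" and closed: "vector_closure V0 \<subseteq> V0"
    and not_in: "\<And>q a u. \<lbrakk>0 < q; q < s; d \<le> multiplicity CARD('p) q; u \<in> V0\<rbrakk> \<Longrightarrow>
      (xpow (int q) - 1) *s v \<noteq> (xpow (int s) - 1) *s a + (xpow (int CARD('p) ^ d) - 1) *s u"
  shows "closedin (pro_p_topology CARD('p) lamplighter) V"
  unfolding closedin_iff
proof (intro allI impI)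
  fix w j
  assume *: "\<forall>m. \<exists>k. \<exists>u\<in>V0. w - level k - u \<in> congruence_vectors m \<and> int CARD('p) ^ m dvd j - int s * k"
  have "CARD('p) ^ d dvd s" unfolding d_eq by (rule multiplicity_dvd)
  then obtain s' where s': "s = CARD('p) ^ d * s'" ..
  have P_s: "int CARD('p) ^ d dvd int s" using s' by simp
  have P_j: "int CARD('p) ^ d dvd j"
  proof -
    obtain k where "int CARD('p) ^ d dvd j - int s * k" using * by blast
    then have "int CARD('p) ^ d dvd (j - int s * k) + int s * k" using P_s by (intro dvd_add dvd_mult2)
    then show ?thesis by simp
  qed
  \<comment> \<open>As p^d divides s, the quotient H of x^s - 1 by y - 1 is exact; it preserves V0
    because y does.\<close>
  obtain H where H: "(xpow (int CARD('p) ^ d) - 1) * H = xpow (int CARD('p) ^ d * int s') - 1"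
    "\<And>u. u \<in> V0 \<Longrightarrow> H *s u \<in> V0"
    using geometric_multiplier[OF V0_zero V0_diff inv, of s'] by blast
  have H_s: "(xpow (int CARD('p) ^ d) - 1) * H = xpow (int s) - 1" using H(1) s' by simp
  define b where "b = (xpow j - 1) *s v - (xpow (int s) - 1) *s w"
  have b_approx: "\<exists>u\<in>V0. b - (xpow (int CARD('p) ^ d) - 1) *s u \<in> congruence_vectors m" for m
  proof -
    obtain k u where u: "u \<in> V0" and w: "w - level k - u \<in> congruence_vectors m"
      and k: "int CARD('p) ^ m dvd j - int s * k" using * by blast
    have "b - (xpow (int CARD('p) ^ d) - 1) *s (- (H *s u))
      = (xpow j - 1) *s v - (xpow (int s) - 1) *s w + ((xpow (int CARD('p) ^ d) - 1) * H) *s u"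
      by (simp add: b_def vec_eq_iff algebra_simps)
    also have "\<dots> = (xpow j - 1) *s v - (xpow (int s) - 1) *s level k
        - (xpow (int s) - 1) *s (w - level k - u)"
      unfolding H_s by (simp add: vec_eq_iff algebra_simps)
    also have "\<dots> = (xpow j - xpow (int s * k)) *s v - (xpow (int s) - 1) *s (w - level k - u)"
      unfolding level_eq by (simp add: vec_eq_iff algebra_simps)
    also have "\<dots> \<in> congruence_vectors m"
      by (intro congruence_vectors_diff congruence_vectors_smult w
          xpow_diff_smult_congruence_vectors k)
    finally show ?thesis
      using V0_uminus[OF H(2)[OF u]] by blast
  qed
  \<comment> \<open>The congruence vectors of level d are exactly the multiples of y - 1, so one
    approximation at that level makes b divisible by y - 1.\<close>
  obtain b' where b': "b = (xpow (int CARD('p) ^ d) - 1) *s b'"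
  proof -
    obtain u where "b - (xpow (int CARD('p) ^ d) - 1) *s u \<in> congruence_vectors d" using b_approx by blast
    then obtain c where "b - (xpow (int CARD('p) ^ d) - 1) *s u = (xpow (int CARD('p) ^ d) - 1) *s c"
      unfolding congruence_vectors_def multiples_def by blast
    then have "b = (xpow (int CARD('p) ^ d) - 1) *s (c + u)" by (simp add: vector_add_ldistrib algebra_simps)
    then show ?thesis by (rule that)
  qed
  have "b' \<in> vector_closure V0"
    unfolding vector_closure_def mem_Collect_eq
  proof
    fix m
    obtain u where "u \<in> V0" "b - (xpow (int CARD('p) ^ d) - 1) *s u \<in> congruence_vectors (m + d + 1)"
      using b_approx by blast
    then have "(xpow (int CARD('p) ^ d) - 1) *s (b' - u) \<in> congruence_vectors (m + d + 1)"
      by (simp add: b' vector_ssub_ldistrib)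
    then show "\<exists>u\<in>V0. b' - u \<in> congruence_vectors m" using power_cancel \<open>u \<in> V0\<close> by blast
  qed
  then have "b' \<in> V0" using closed by blast
  have eq: "(xpow j - 1) *s v = (xpow (int s) - 1) *s w + (xpow (int CARD('p) ^ d) - 1) *s b'"
    using b' by (simp add: b_def algebra_simps)
  define q where "q = nat (j mod int s)"
  have int_q: "int q = j mod int s" using assms(1) by (simp add: q_def)
  have "q = 0"
  proof (rule ccontr)
    assume "q \<noteq> 0"
    have "q < s" using assms(1) by (simp add: q_def nat_less_iff)
    have "int CARD('p) ^ d dvd int q" unfolding int_q using P_j P_s by (simp add: dvd_mod)
    then have "CARD('p) ^ d dvd q" by (metis of_nat_dvd_iff of_nat_power)
    then have "d \<le> multiplicity CARD('p) q"
      using \<open>q \<noteq> 0\<close> prime_gt_1_nat[OF prime_card[where 'a = 'p]] by (intro multiplicity_geI) auto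
    have "int s dvd int q - j" unfolding int_q by (metis dvd_minus_mod dvd_diff_commute)
    \<comment> \<open>Replacing j by its residue q changes the left side by (x^s - 1) c v, which is
      absorbed into the free vector a.\<close>
    then obtain c :: "'p laurent" where c: "xpow (int q) - xpow j = (xpow (int s) - 1) * c"
      using xpow_diff_dvd by (metis dvdE)
    have "(xpow (int q) - 1) *s v = (xpow (int q) - xpow j) *s v + (xpow j - 1) *s v"
      by (simp add: vec_eq_iff algebra_simps)
    also have "\<dots> = (xpow (int s) - 1) *s (w + c *s v) + (xpow (int CARD('p) ^ d) - 1) *s b'"
      unfolding eq c by (simp add: vec_eq_iff algebra_simps)
    finally show False
      using not_in[of q b' "w + c *s v"] \<open>q \<noteq> 0\<close> \<open>q < s\<close> \<open>d \<le> _\<close> \<open>b' \<in> V0\<close> by blast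
  qed
  then have "int s dvd j" using int_q by (simp add: dvd_eq_mod_eq_0)
  then obtain k where k: "j = int s * k" ..
  \<comment> \<open>After multiplication by x^s - 1 the difference is (y - 1) b', which G b' in V0
    reproduces up to level m + d + 1.\<close>
  have "level k - w \<in> vector_closure V0"
    unfolding vector_closure_def mem_Collect_eq
  proof
    fix m
    let ?l = "m + d + 1"
    obtain G where G: "xpow (int CARD('p) ^ ?l) - 1 dvd (xpow (int s) - 1) * G - (xpow (int CARD('p) ^ d) - 1)"
      "\<And>u. u \<in> V0 \<Longrightarrow> G *s u \<in> V0"
      using exists_power_multiplier[OF assms(1), of "m + d + 1"] by blast
    have "(xpow (int s) - 1) *s (level k - w - G *s b')
      = (xpow (int s) - 1) *s level k - (xpow (int s) - 1) *s w - ((xpow (int s) - 1) * G) *s b'"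
      by (simp add: vec_eq_iff algebra_simps)
    also have "\<dots> = - (((xpow (int s) - 1) * G - (xpow (int CARD('p) ^ d) - 1)) *s b')"
      unfolding level_eq k[symmetric] eq by (simp add: vec_eq_iff algebra_simps)
    also have "\<dots> \<in> congruence_vectors ?l"
      unfolding congruence_vectors_def using G(1) by (intro multiples_uminus smult_multiples)
    finally have "level k - w - G *s b' \<in> congruence_vectors m" by (rule s_cancel[OF assms(1)])
    then show "\<exists>u\<in>V0. level k - w - u \<in> congruence_vectors m" using G(2)[OF \<open>b' \<in> V0\<close>] by blast
  qed
  then have "level k - w \<in> V0" using closed by blast
  then have "w - level k \<in> V0" using V0_uminus by fastforce
  then show "(w, j) \<in> V" unfolding k in_V_level_iff .
qed

lemma closedin_iff_pos:
  assumes "0 < s"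
  shows "closedin (pro_p_topology CARD('p) lamplighter) V \<longleftrightarrow>
    period V0 \<noteq> \<infinity> \<and> the_enat (period V0) dvd CARD('p) ^ d \<and> (\<exists>j. det_star V0 = [:1, -1:] ^ j) \<and>
    (\<forall>q. 0 < q \<and> q < s \<and> d \<le> multiplicity CARD('p) q \<longrightarrow>
      (xpow (int q) - 1) *s v \<notin> {(xpow (int s) - 1) *s a + (xpow (int CARD('p) ^ d) - 1) *s u |a u. u \<in> V0})"
    (is "?closed \<longleftrightarrow> ?conditions")
proof -
  \<comment> \<open>Invariance under x^s makes s an admissible exponent, so a least one
    exists.\<close>
  have finite: "period V0 \<noteq> \<infinity>"
    unfolding period_finite_iff using assms shift_invariant_s by blast
  note period = period_minimal[OF finite]
  show ?thesis
  proof
    assume closed: ?closed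
    have "int (the_enat (period V0)) dvd int (CARD('p) ^ d)"
      using period(3)[OF closed_imp_shift_invariant[OF assms closed]] by simp
    then have dvd: "the_enat (period V0) dvd CARD('p) ^ d" by (simp only: of_nat_dvd_iff)
    moreover have "\<exists>j. det_star V0 = [:1, -1:] ^ j"
      using closed_imp_closed_V0[OF closed]
        vector_closure_subset_iff_det_star[OF V0_zero V0_diff finite dvd] by blast
    ultimately show ?conditions using finite closed_imp_not_in[OF assms closed] by blast
  next
    assume conditions: ?conditions
    then have dvd: "the_enat (period V0) dvd CARD('p) ^ d" by blast
    then have "int (the_enat (period V0)) dvd int CARD('p) ^ d" by (metis of_nat_dvd_iff of_nat_power)
    then have "shift_invariant (int CARD('p) ^ d) V0" using shift_invariant_mult[OF period(2)] by (auto elim!: dvdE)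
    moreover have "vector_closure V0 \<subseteq> V0"
      using conditions vector_closure_subset_iff_det_star[OF V0_zero V0_diff finite dvd] by blast
    ultimately show ?closed using conditions by (intro closedinI[OF assms]) blast+
  qed
qed

end

theorem theorem3p35:
  fixes V :: "(('p::prime_card, 'n::finite) lamp \<times> int) set"
    and s :: nat
    and V0 :: "('p, 'n) lamp set"
    and v :: "('p, 'n) lamp"
  assumes "subgroup V lamplighter"
    and "subgroup_triple V s V0 v"
  shows "closedin (pro_p_topology CARD('p) lamplighter) V \<longleftrightarrow>
    (s = 0 \<and> closed_in_completion V0) \<or>
    (s > 0 \<and>
     period V0 \<noteq> \<infinity> \<and> the_enat (period V0) dvd CARD('p) ^ multiplicity CARD('p) s \<and>
     (\<exists>j::nat. det_star V0 = [:1, -1:] ^ j) \<and>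
     (\<forall>q::nat. 0 < q \<and> q < s \<and> multiplicity CARD('p) q \<ge> multiplicity CARD('p) s \<longrightarrow>
        (xpow (int q) - 1) *s v \<notin>
          {(xpow (int s) - 1) *s a
             + (xpow 1 - 1) ^ (CARD('p) ^ multiplicity CARD('p) s) *s u |a u. u \<in> V0}))"
proof -
  interpret lamplighter_subgroup V s V0 v "multiplicity CARD('p) s"
    using assms refl by (rule lamplighter_subgroup.intro)
  show ?thesis
  proof (cases "s = 0")
    case True
    then show ?thesis using closedin_iff_zero by (simp add: closed_in_completion_iff)
  next
    case False
    then show ?thesis using closedin_iff_pos unfolding xpow_minus_one_power by simp
  qed
qed

end
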